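(* Fix an integer $k>0$ and $P\in\mathbb{R}^d$. Let $H:\mathbb{T}^d\times\mathbb{R}^d\to\mathbb{R}$ be a smooth Hamiltonian satisfying: (i) (strict convexity) there is $\rho>0$ such that $\sum_{i,j=1}^d H_{p_ip_j}(x,p)\xi_i\xi_j\geq \rho|\xi|^2$ for all $p,\xi\in\mathbb{R}^d$, $x\in\mathbb{T}^d$; (ii) (growth bounds) there is $C>0$ such that $|D_p^2H(x,p)|\leq C$, $|D^2_{x,p}H(x,p)|\leq C(1+|p|)$ and $|D_x^2H(x,p)|\leq C(1+|p|^2)$ for all $(x,p)\in\mathbb{T}^d\times\mathbb{R}^d$. Suppose that $(\boldsymbol{m},\boldsymbol{u})\in C^1\left([0,\infty);C^1_+(\mathbb{T}^d)\times C^2(\mathbb{T}^d)\right)$ is a solution of the Hessian Riemannian flow $$\begin{bmatrix}\dot{\boldsymbol{m}}\\ \dot{\boldsymbol{u}}\end{bmatrix}=-\begin{bmatrix}\boldsymbol{m}\left(-H(x,P+D_x\boldsymbol{u})+\overline{\boldsymbol{H}}(P)+\frac1k\ln\boldsymbol{m}\right)\\ -\operatorname{div}\left(D_pH(x,P+D_x\boldsymbol{u})\boldsymbol{m}\right)\end{bmatrix},\qquad \overline{\boldsymbol{H}}(P)=\frac{\int_{\mathbb{T}^d}\left(\boldsymbol{m}H(x,P+D_x\boldsymbol{u})-\frac1k\boldsymbol{m}\ln\boldsymbol{m}\right)dx}{\int_{\mathbb{T}^d}\boldsymbol{m}\,dx},$$ with $\int_{\mathbb{T}^d}\boldsymbol{m}(0)\,dx=1$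 and $\int_{\mathbb{T}^d}\boldsymbol{u}(0)\,dx=0$. Let $(m^*,u^* )$ be the smooth solution, with $\int_{\mathbb{T}^d}u^*\,dx=0$, of $$\begin{cases}H(x,P+D_xu^* )=\overline{H}^k(P)+\frac1k\ln m^*,\\ -\operatorname{div}\left(m^*D_pH(x,P+D_xu^* )\right)=0,\end{cases}\qquad \overline{H}^k(P)=\frac1k\ln\left(\int_{\mathbb{T}^d}e^{kH(x,P+D_xu^* )}dx\right).$$ Then there exists a sequence $t_i\to+\infty$ such that $\boldsymbol{u}(t_i)\to u^*$ in $W^{1,2}(\mathbb{T}^d)$ as $i\to+\infty$. Moreover, $\boldsymbol{u}(t)\to u^*$ in $L^2(\mathbb{T}^d)$ and $\boldsymbol{m}(t)\to m^*$ in $L^1(\mathbb{T}^d)$ as $t\to\infty$.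
   Context: $\mathbb{T}^d$ is the unit $d$-dimensional torus, identified with $[0,1]^d$ with periodic identification. $C^1_+(\mathbb{T}^d)$ is the set of strictly positive functions in $C^1(\mathbb{T}^d)$. For a space $Y$ of functions on $\mathbb{T}^d$, $C^1([0,\infty);Y)$ denotes continuously differentiable functions of $t\in[0,\infty)$ with values in $Y$; the dot denotes the time derivative. $\operatorname{div}$ and $D_x$ are taken in $x$, and $D_p$ in the second variable of $H$. Under (i) and (ii), for each $k$ the stationary system has a unique smooth solution $(m^*,u^* )$ with $\int_{\mathbb{T}^d}u^*\,dx=0$ (known result of Evans); the formula for $\overline{H}^k(P)$ forces $\int_{\mathbb{T}^d} m^*\,dx=1$. *)

theory Defs
  imports "HOL-Analysis.Analysis"
begin

definition partial_deriv ::
    "'a::euclidean_space \<Rightarrow> ('a \<Rightarrow> real) \<Rightarrow> 'a \<Rightarrow> real" where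
  "partial_deriv b f x = frechet_derivative f (at x) b"

primrec Ck :: "nat \<Rightarrow> ('a::euclidean_space \<Rightarrow> real) \<Rightarrow> bool" where
  "Ck 0 f = continuous_on UNIV f"
| "Ck (Suc r) f =
     ((\<forall>x. f differentiable (at x)) \<and> (\<forall>b\<in>Basis. Ck r (partial_deriv b f)))"

definition smooth :: "('a::euclidean_space \<Rightarrow> real) \<Rightarrow> bool" where
  "smooth f \<longleftrightarrow> (\<forall>r. Ck r f)"

definition grad :: "(real^'n \<Rightarrow> real) \<Rightarrow> real^'n \<Rightarrow> real^'n" where
  "grad f x = (\<chi> i. partial_deriv (axis i 1) f x)"

definition hessian :: "(real^'n \<Rightarrow> real) \<Rightarrow> real^'n \<Rightarrow> real^'n^'n" where
  "hessian f x =
     (\<chi> i j. partial_deriv (axis i 1) (partial_deriv (axis j 1) f) x)"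

definition divergence :: "(real^'n \<Rightarrow> real^'n) \<Rightarrow> real^'n \<Rightarrow> real" where
  "divergence F x = (\<Sum>i\<in>UNIV. partial_deriv (axis i 1) (\<lambda>y. F y $ i) x)"

text \<open>A function on the torus is a function on the whole of \<open>real^'n\<close> that is periodic with
  respect to the integer lattice; integration is over the unit cube with Lebesgue measure.\<close>

definition periodic :: "(real^'n \<Rightarrow> 'b) \<Rightarrow> bool" where
  "periodic f \<longleftrightarrow> (\<forall>x i. f (x + axis i 1) = f x)"

definition Ck_torus :: "nat \<Rightarrow> (real^'n \<Rightarrow> real) set" where
  "Ck_torus r = {f. periodic f \<and> Ck r f}"

definition C1_pos_torus :: "(real^'n \<Rightarrow> real) set" where
  "C1_pos_torus = {f \<in> Ck_torus 1. \<forall>x. f x > 0}"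

definition smooth_torus :: "(real^'n \<Rightarrow> real) set" where
  "smooth_torus = {f. periodic f \<and> smooth f}"

abbreviation torus :: "(real^'n) measure" where
  "torus \<equiv> lebesgue_on (cbox 0 1)"

text \<open>The suprema below are finite for functions in \<open>Ck_torus 1\<close> and \<open>Ck_torus 2\<close>,
  respectively, and the norms are only used there.\<close>

definition C1_norm :: "(real^'n \<Rightarrow> real) \<Rightarrow> real" where
  "C1_norm f = (SUP x. \<bar>f x\<bar>) + (SUP x. norm (grad f x))"

definition C2_norm :: "(real^'n \<Rightarrow> real) \<Rightarrow> real" where
  "C2_norm f =
     (SUP x. \<bar>f x\<bar>) + (SUP x. norm (grad f x)) + (SUP x. norm (hessian f x))"

text \<open>\<open>C1_curve Y N f f'\<close>: the map \<open>t \<mapsto> f t\<close> is in \<open>C\<^sup>1([0,\<infty>); Y)\<close>, where \<open>Y\<close> is a space of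
  functions normed by \<open>N\<close>, and \<open>f'\<close> is its time derivative (one-sided at \<open>t = 0\<close>). The
  difference quotient converges in the norm \<open>N\<close>, not merely pointwise.\<close>

definition C1_curve ::
    "('a \<Rightarrow> real) set \<Rightarrow> (('a \<Rightarrow> real) \<Rightarrow> real) \<Rightarrow>
     (real \<Rightarrow> 'a \<Rightarrow> real) \<Rightarrow> (real \<Rightarrow> 'a \<Rightarrow> real) \<Rightarrow> bool" where
  "C1_curve Y N f f' \<longleftrightarrow>
     (\<forall>t\<ge>0. f t \<in> Y \<and> f' t \<in> Y) \<and>
     (\<forall>t\<ge>0. ((\<lambda>s. N (\<lambda>x. (f s x - f t x) / (s - t) - f' t x)) \<longlongrightarrow> 0)
               (at t within {0..})) \<and>
     (\<forall>t\<ge>0. ((\<lambda>s. N (\<lambda>x. f' s x - f' t x)) \<longlongrightarrow> 0) (at t within {0..}))"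

definition in_Lp :: "real \<Rightarrow> (real^'n \<Rightarrow> 'b::euclidean_space) \<Rightarrow> bool" where
  "in_Lp q f \<longleftrightarrow>
     f \<in> borel_measurable torus \<and> integrable torus (\<lambda>x. norm (f x) powr q)"

definition Lp_norm :: "real \<Rightarrow> (real^'n \<Rightarrow> 'b::euclidean_space) \<Rightarrow> real" where
  "Lp_norm q f = (LINT x|torus. norm (f x) powr q) powr (1 / q)"

definition converges_Lp ::
    "real \<Rightarrow> ('s \<Rightarrow> real^'n \<Rightarrow> 'b::euclidean_space) \<Rightarrow> (real^'n \<Rightarrow> 'b) \<Rightarrow> 's filter \<Rightarrow> bool"
  where
  "converges_Lp q fs f F \<longleftrightarrow>
     (\<forall>\<^sub>F s in F. in_Lp q (fs s)) \<and> in_Lp q f \<and>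
     ((\<lambda>s. Lp_norm q (\<lambda>x. fs s x - f x)) \<longlongrightarrow> 0) F"

definition has_weak_grad :: "(real^'n \<Rightarrow> real) \<Rightarrow> (real^'n \<Rightarrow> real^'n) \<Rightarrow> bool" where
  "has_weak_grad f g \<longleftrightarrow>
     (\<forall>\<phi>\<in>smooth_torus. \<forall>i.
        (LINT x|torus. f x * partial_deriv (axis i 1) \<phi> x) = - (LINT x|torus. g x $ i * \<phi> x))"

text \<open>Convergence in \<open>W\<^sup>1\<^sup>,\<^sup>2\<close>: weak gradients are unique almost everywhere, so the choice of
  \<open>G\<close> and \<open>g\<close> is immaterial.\<close>

definition converges_W12 ::
    "('s \<Rightarrow> real^'n \<Rightarrow> real) \<Rightarrow> (real^'n \<Rightarrow> real) \<Rightarrow> 's filter \<Rightarrow> bool" where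
  "converges_W12 fs f F \<longleftrightarrow>
     (\<exists>G g. (\<forall>\<^sub>F s in F. has_weak_grad (fs s) (G s)) \<and> has_weak_grad f g \<and>
            converges_Lp 2 fs f F \<and> converges_Lp 2 G g F)"

text \<open>A Hamiltonian is curried: \<open>H x p\<close>. Matrices carry the Euclidean (Frobenius) norm.\<close>

definition DpH :: "(real^'n \<Rightarrow> real^'n \<Rightarrow> real) \<Rightarrow> real^'n \<Rightarrow> real^'n \<Rightarrow> real^'n" where
  "DpH H x p = grad (H x) p"

definition D2ppH :: "(real^'n \<Rightarrow> real^'n \<Rightarrow> real) \<Rightarrow> real^'n \<Rightarrow> real^'n \<Rightarrow> real^'n^'n" where
  "D2ppH H x p = hessian (H x) p"

definition D2xpH :: "(real^'n \<Rightarrow> real^'n \<Rightarrow> real) \<Rightarrow> real^'n \<Rightarrow> real^'n \<Rightarrow> real^'n^'n" where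
  "D2xpH H x p = (\<chi> i j. partial_deriv (axis i 1) (\<lambda>y. DpH H y p $ j) x)"

definition D2xxH :: "(real^'n \<Rightarrow> real^'n \<Rightarrow> real) \<Rightarrow> real^'n \<Rightarrow> real^'n \<Rightarrow> real^'n^'n" where
  "D2xxH H x p = hessian (\<lambda>y. H y p) x"

definition smooth_hamiltonian :: "(real^'n \<Rightarrow> real^'n \<Rightarrow> real) \<Rightarrow> bool" where
  "smooth_hamiltonian H \<longleftrightarrow>
     (\<forall>p. periodic (\<lambda>x. H x p)) \<and> smooth (\<lambda>(x, p). H x p)"

definition strictly_convex_in_p :: "(real^'n \<Rightarrow> real^'n \<Rightarrow> real) \<Rightarrow> bool" where
  "strictly_convex_in_p H \<longleftrightarrow>
     (\<exists>\<rho>>0. \<forall>x p \<xi>.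
        (\<Sum>i\<in>UNIV. \<Sum>j\<in>UNIV. D2ppH H x p $ i $ j * \<xi> $ i * \<xi> $ j) \<ge> \<rho> * (norm \<xi>)\<^sup>2)"

definition growth_bounds :: "(real^'n \<Rightarrow> real^'n \<Rightarrow> real) \<Rightarrow> bool" where
  "growth_bounds H \<longleftrightarrow>
     (\<exists>C>0. \<forall>x p.
        norm (D2ppH H x p) \<le> C \<and>
        norm (D2xpH H x p) \<le> C * (1 + norm p) \<and>
        norm (D2xxH H x p) \<le> C * (1 + (norm p)\<^sup>2))"

text \<open>The time-dependent constant of the flow, for given \<open>m = m(t)\<close> and \<open>u = u(t)\<close>.\<close>

definition Hbar_flow ::
    "nat \<Rightarrow> (real^'n \<Rightarrow> real^'n \<Rightarrow> real) \<Rightarrow> real^'n \<Rightarrow>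
     (real^'n \<Rightarrow> real) \<Rightarrow> (real^'n \<Rightarrow> real) \<Rightarrow> real" where
  "Hbar_flow k H P m u =
     (LINT x|torus. m x * H x (P + grad u x) - 1 / real k * m x * ln (m x)) /
     (LINT x|torus. m x)"

definition Hbar_stat ::
    "nat \<Rightarrow> (real^'n \<Rightarrow> real^'n \<Rightarrow> real) \<Rightarrow> real^'n \<Rightarrow> (real^'n \<Rightarrow> real) \<Rightarrow> real" where
  "Hbar_stat k H P u =
     1 / real k * ln (LINT x|torus. exp (real k * H x (P + grad u x)))"

text \<open>\<open>m'\<close> and \<open>u'\<close> are the time derivatives of \<open>m\<close> and \<open>u\<close> as curves in \<open>C\<^sup>1\<close> and \<open>C\<^sup>2\<close>.\<close>

definition hessian_riemannian_flow ::
    "nat \<Rightarrow> (real^'n \<Rightarrow> real^'n \<Rightarrow> real) \<Rightarrow> real^'n \<Rightarrow>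
     (real \<Rightarrow> real^'n \<Rightarrow> real) \<Rightarrow> (real \<Rightarrow> real^'n \<Rightarrow> real) \<Rightarrow> bool" where
  "hessian_riemannian_flow k H P m u \<longleftrightarrow>
     (\<forall>t\<ge>0. m t \<in> C1_pos_torus) \<and>
     (\<exists>m' u'.
        C1_curve (Ck_torus 1) C1_norm m m' \<and>
        C1_curve (Ck_torus 2) C2_norm u u' \<and>
        (\<forall>t\<ge>0. \<forall>x.
           m' t x = - (m t x * (- H x (P + grad (u t) x) + Hbar_flow k H P (m t) (u t)
                                + 1 / real k * ln (m t x))) \<and>
           u' t x = - (- divergence (\<lambda>y. m t y *\<^sub>R DpH H y (P + grad (u t) y)) x)))"

definition stationary_solution ::
    "nat \<Rightarrow> (real^'n \<Rightarrow> real^'n \<Rightarrow> real) \<Rightarrow> real^'n \<Rightarrow>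
     (real^'n \<Rightarrow> real) \<Rightarrow> (real^'n \<Rightarrow> real) \<Rightarrow> bool" where
  "stationary_solution k H P m u \<longleftrightarrow>
     m \<in> smooth_torus \<and> (\<forall>x. m x > 0) \<and> u \<in> smooth_torus \<and>
     (\<forall>x. H x (P + grad u x) = Hbar_stat k H P u + 1 / real k * ln (m x)) \<and>
     (\<forall>x. - divergence (\<lambda>y. m y *\<^sub>R DpH H y (P + grad u y)) x = 0)"

end

theory Submission
  imports Defs
begin

text \<open>Along the flow, the functional
\<open>\<Phi>(t) = \<integral> m* ln (m* / m(t)) dx + 1/2 \<integral> (u(t) - u*)\<^sup>2 dx\<close> decreases. Differentiate it, insert the flow,
integrate by parts, and subtract the stationary system tested against \<open>(m - m*, u - u*)\<close>. Because
\<open>m(t)\<close> and \<open>m*\<close> both have mass 1, the constants \<open>Hbar\<close> cancel, and what remains is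
\<open>- \<Phi>' = \<integral> m B(P + Du*, P + Du) + \<integral> m* B(P + Du, P + Du*) + 1/k \<integral> (m - m*) (ln m - ln m*)\<close>, where
\<open>B(q, p) = H(x, q) - H(x, p) - D\<^sub>pH(x, p) \<bullet> (q - p)\<close> is at least \<open>\<rho>/2 |q - p|\<^sup>2\<close> by strict convexity
(\<open>lyapunov_derivative\<close>, \<open>hamiltonian_convexity\<close>). All three terms are nonnegative.

As \<open>\<Phi>\<close> is bounded below by zero, its dissipation \<open>- \<Phi>'\<close> tends to zero along some times \<open>\<tau>\<^sub>i \<rightarrow> \<infinity>\<close>
(\<open>dissipation\<close>). The continuous positive function \<open>m*\<close> is bounded below by a positive constant, so the
dissipation controls \<open>\<integral> |Du - Du*|\<^sup>2\<close>; as \<open>u - u*\<close> has mean zero, the Poincare inequality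
(\<open>poincare_torus\<close>) then controls \<open>\<integral> (u - u*)\<^sup>2\<close>. The last term of the dissipation is the sum of
the relative entropies of \<open>m\<close> and \<open>m*\<close> in both orders, hence it controls the entropy part of \<open>\<Phi>\<close>. Altogether
\<open>\<Phi>\<close> is bounded by a multiple of its own dissipation (\<open>dissipation_controls\<close>). So
\<open>u(\<tau>\<^sub>i) \<rightarrow> u*\<close> in \<open>W\<^sup>1\<^sup>,\<^sup>2\<close> and \<open>\<Phi>(\<tau>\<^sub>i) \<rightarrow> 0\<close>, and by monotonicity \<open>\<Phi>(t) \<rightarrow> 0\<close> for the whole trajectory. This
is the \<open>L\<^sup>2\<close> convergence of \<open>u\<close>; since relative entropy bounds the squared Hellinger distance, it is also the
\<open>L\<^sup>1\<close> convergence of \<open>m\<close>.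

Two facts about periodic functions carry the integrations: integrals over the unit cube are
invariant under translation (\<open>tint_shift\<close>), and therefore partial derivatives have integral zero
(\<open>tint_partial_deriv_eq_0\<close>). The Poincare inequality also follows from translation invariance,
by averaging increments of the function.\<close>

section \<open>Continuously differentiable functions\<close>

text \<open>Continuity of the derivative is required direction by direction. In finite dimension this is
equivalent to continuity in operator norm, and it matches the partial derivatives in \<open>Ck\<close>.\<close>

definition cont_diff :: "('a::euclidean_space \<Rightarrow> 'b::real_normed_vector) \<Rightarrow> bool" where
  "cont_diff f \<longleftrightarrow> (\<forall>x. f differentiable (at x)) \<and>
     (\<forall>h. continuous_on UNIV (\<lambda>x. frechet_derivative f (at x) h))"

lemma cont_diffI:
  assumes "\<And>x. (f has_derivative f' x) (at x)" "\<And>h. continuous_on UNIV (\<lambda>x. f' x h)"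
  shows "cont_diff f"
proof -
  have "frechet_derivative f (at x) = f' x" for x
    using frechet_derivative_at[OF assms(1)] by simp
  then show ?thesis
    unfolding cont_diff_def using assms by (auto intro: differentiableI)
qed

lemma cont_diff_has_derivative:
  "cont_diff f \<Longrightarrow> (f has_derivative frechet_derivative f (at x)) (at x)"
  unfolding cont_diff_def using frechet_derivative_works by blast

lemma frechet_derivative_eqI:
  "(f has_derivative f') (at x) \<Longrightarrow> frechet_derivative f (at x) = f'"
  by (rule frechet_derivative_at[symmetric])

lemma cont_diff_continuous: "cont_diff f \<Longrightarrow> continuous_on UNIV f"
  unfolding cont_diff_def
  by (simp add: continuous_at_imp_continuous_on differentiable_imp_continuous_within)

lemma cont_diff_frechet: "cont_diff f \<Longrightarrow> continuous_on UNIV (\<lambda>x. frechet_derivative f (at x) h)"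
  unfolding cont_diff_def by blast

text \<open>Expanding the direction in the basis reduces continuity of the derivative, jointly in point and
direction, to finitely many fixed directions.\<close>

lemma frechet_derivative_basis_sum:
  fixes f :: "'a::euclidean_space \<Rightarrow> 'b::real_normed_vector"
  assumes "f differentiable (at x)"
  shows "frechet_derivative f (at x) h = (\<Sum>b\<in>Basis. (h \<bullet> b) *\<^sub>R frechet_derivative f (at x) b)"
proof -
  interpret D: bounded_linear "frechet_derivative f (at x)"
    using assms frechet_derivative_works has_derivative_bounded_linear by blast
  have "frechet_derivative f (at x) h = frechet_derivative f (at x) (\<Sum>b\<in>Basis. (h \<bullet> b) *\<^sub>R b)"
    by (simp add: euclidean_representation)
  then show ?thesis by (simp add: D.sum D.scaleR)
qed

lemma cont_diff_frechet_continuous: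
  assumes "cont_diff f" "continuous_on S g" "continuous_on S h"
  shows "continuous_on S (\<lambda>x. frechet_derivative f (at (g x)) (h x))"
proof -
  have "f differentiable (at x)" for x using assms(1) by (simp add: cont_diff_def)
  note expand = frechet_derivative_basis_sum[OF this]
  have "continuous_on S (\<lambda>x. frechet_derivative f (at (g x)) b)" for b
    using assms(1) assms(2) unfolding cont_diff_def
    by (auto intro: continuous_on_compose2[where t = UNIV and g = "\<lambda>x. frechet_derivative f (at x) b"])
  then show ?thesis
    unfolding expand[of _ "h _"]
    by (intro continuous_intros assms) auto
qed

lemma cont_diff_const: "cont_diff (\<lambda>x. c)"
  by (rule cont_diffI[OF has_derivative_const]) simp

lemma cont_diff_bounded_linear: "bounded_linear f \<Longrightarrow> cont_diff f"
  by (rule cont_diffI[OF bounded_linear_imp_has_derivative]) simp_all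

lemma cont_diff_compose:
  assumes "cont_diff f" "cont_diff g"
  shows "cont_diff (\<lambda>x. f (g x))"
proof (rule cont_diffI)
  show "((\<lambda>x. f (g x)) has_derivative
      (\<lambda>h. frechet_derivative f (at (g x)) (frechet_derivative g (at x) h))) (at x)" for x
    using has_derivative_compose[OF cont_diff_has_derivative[OF assms(2)] cont_diff_has_derivative[OF assms(1)]] .
  show "continuous_on UNIV (\<lambda>x. frechet_derivative f (at (g x)) (frechet_derivative g (at x) h))" for h
    by (rule cont_diff_frechet_continuous[OF assms(1) cont_diff_continuous[OF assms(2)] cont_diff_frechet[OF assms(2)]])
qed

lemma cont_diff_add:
  assumes "cont_diff f" "cont_diff g" shows "cont_diff (\<lambda>x. f x + g x)"
  using assms
  by (intro cont_diffI[OF has_derivative_add[OF cont_diff_has_derivative cont_diff_has_derivative]])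
    (auto intro!: continuous_intros cont_diff_frechet)

lemma cont_diff_sum:
  assumes "\<And>i. i \<in> I \<Longrightarrow> cont_diff (f i)" shows "cont_diff (\<lambda>x. \<Sum>i\<in>I. f i x)"
  using assms
  by (induction I rule: infinite_finite_induct) (auto simp: cont_diff_const cont_diff_add)

lemma cont_diff_scaleR:
  assumes f: "cont_diff f" and g: "cont_diff g" shows "cont_diff (\<lambda>x. f x *\<^sub>R g x)"
proof (rule cont_diffI[OF has_derivative_scaleR[OF cont_diff_has_derivative[OF f] cont_diff_has_derivative[OF g]]])
  note [continuous_intros] = f[THEN cont_diff_continuous] g[THEN cont_diff_continuous]
    f[THEN cont_diff_frechet] g[THEN cont_diff_frechet]
  show "continuous_on UNIV (\<lambda>x. f x *\<^sub>R frechet_derivative g (at x) h + frechet_derivative f (at x) h *\<^sub>R g x)" for h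
    by (intro continuous_intros)
qed

lemma cont_diff_mult:
  fixes f g :: "_ \<Rightarrow> real"
  assumes "cont_diff f" "cont_diff g" shows "cont_diff (\<lambda>x. f x * g x)"
  using cont_diff_scaleR[OF assms] by simp

lemma cont_diff_diff:
  assumes "cont_diff f" "cont_diff g" shows "cont_diff (\<lambda>x. f x - g x)"
  using assms
  by (intro cont_diffI[OF has_derivative_diff[OF cont_diff_has_derivative cont_diff_has_derivative]])
    (auto intro!: continuous_intros cont_diff_frechet)

lemma cont_diff_Pair:
  assumes "cont_diff f" "cont_diff g" shows "cont_diff (\<lambda>x. (f x, g x))"
  using assms
  by (intro cont_diffI[OF has_derivative_Pair[OF cont_diff_has_derivative cont_diff_has_derivative]])
    (auto intro!: continuous_intros cont_diff_frechet)

lemma cont_diff_vec: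
  fixes f :: "'a::euclidean_space \<Rightarrow> real^'n"
  assumes "\<And>i. cont_diff (\<lambda>x. f x $ i)" shows "cont_diff f"
proof -
  have "f = (\<lambda>x. \<Sum>i\<in>UNIV. (f x $ i) *\<^sub>R axis i 1)"
    by (simp add: basis_expansion flip: scalar_mult_eq_scaleR)
  moreover have "cont_diff (\<lambda>x. \<Sum>i\<in>UNIV. (f x $ i) *\<^sub>R (axis i 1 :: real^'n))"
    by (intro cont_diff_sum cont_diff_scaleR assms cont_diff_const)
  ultimately show ?thesis by simp
qed

lemma cont_diff_component:
  fixes f :: "'a::euclidean_space \<Rightarrow> real^'n"
  assumes "cont_diff f" shows "cont_diff (\<lambda>x. f x $ i)"
  using cont_diff_compose[OF cont_diff_bounded_linear[OF bounded_linear_vec_nth] assms] .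

lemma Ck_1_iff_cont_diff: "Ck 1 f \<longleftrightarrow> cont_diff f"
proof
  assume *: "Ck 1 f"
  then have d: "f differentiable (at x)" for x by simp
  have c: "continuous_on UNIV (\<lambda>x. frechet_derivative f (at x) b)" if "b \<in> Basis" for b
    using * that by (simp add: partial_deriv_def[abs_def])
  have "continuous_on UNIV (\<lambda>x. frechet_derivative f (at x) h)" for h
    unfolding frechet_derivative_basis_sum[OF d, of _ h]
    by (intro continuous_on_sum continuous_on_scaleR continuous_on_const c)
  then show "cont_diff f" unfolding cont_diff_def using d by blast
next
  assume "cont_diff f" then show "Ck 1 f"
    by (simp add: cont_diff_def partial_deriv_def[abs_def])
qed

lemma Ck_Suc_imp: "Ck (Suc r) f \<Longrightarrow> Ck r f"
  by (induction r arbitrary: f)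
    (auto simp: continuous_at_imp_continuous_on differentiable_imp_continuous_within)

lemma Ck_2_imp_cont_diff: "Ck 2 f \<Longrightarrow> cont_diff f"
  using Ck_Suc_imp[of 1 f] Ck_1_iff_cont_diff[of f] by (simp add: numeral_2_eq_2)

lemma Ck_2_imp_cont_diff_partial: "Ck 2 f \<Longrightarrow> b \<in> Basis \<Longrightarrow> cont_diff (partial_deriv b f)"
  by (simp add: numeral_2_eq_2 flip: Ck_1_iff_cont_diff)

lemma partial_deriv_diff:
  assumes "cont_diff f" "cont_diff g"
  shows "partial_deriv b (\<lambda>x. f x - g x) x = partial_deriv b f x - partial_deriv b g x"
  unfolding partial_deriv_def
  using frechet_derivative_eqI[OF has_derivative_diff[OF assms[THEN cont_diff_has_derivative]]]
  by simp

lemma partial_deriv_mult: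
  assumes "cont_diff f" "cont_diff g"
  shows "partial_deriv b (\<lambda>x. f x * g x) x = f x * partial_deriv b g x + partial_deriv b f x * g x"
  unfolding partial_deriv_def
  using frechet_derivative_eqI[OF has_derivative_mult[OF assms[THEN cont_diff_has_derivative]]]
  by simp

lemma partial_deriv_divide:
  assumes "cont_diff f"
  shows "partial_deriv b (\<lambda>x. f x / c) x = partial_deriv b f x / c"
  unfolding partial_deriv_def divide_inverse
  using frechet_derivative_eqI[OF has_derivative_mult_left[OF cont_diff_has_derivative[OF assms]], of "inverse c" x]
  by simp

lemma frechet_eq_grad:
  assumes "cont_diff f"
  shows "frechet_derivative f (at x) h = grad f x \<bullet> h"
proof -
  interpret D: bounded_linear "frechet_derivative f (at x)"
    using cont_diff_has_derivative[OF assms] has_derivative_bounded_linear by blast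
  have "frechet_derivative f (at x) h = frechet_derivative f (at x) (\<Sum>i\<in>UNIV. (h $ i) *\<^sub>R axis i 1)"
    using basis_expansion[of h] by (simp add: scalar_mult_eq_scaleR)
  then show ?thesis
    by (simp add: D.sum D.scaleR grad_def partial_deriv_def inner_vec_def mult.commute)
qed

lemma has_derivative_grad:
  assumes "cont_diff f"
  shows "(f has_derivative (\<lambda>h. grad f x \<bullet> h)) (at x)"
proof -
  have "frechet_derivative f (at x) = (\<lambda>h. grad f x \<bullet> h)"
    using frechet_eq_grad[OF assms] by blast
  then show ?thesis using cont_diff_has_derivative[OF assms, of x] by simp
qed

lemma continuous_on_partial: "cont_diff f \<Longrightarrow> continuous_on UNIV (partial_deriv b f)"
  by (simp add: cont_diff_def partial_deriv_def[abs_def])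

lemma continuous_on_vecI:
  fixes f :: "'a::topological_space \<Rightarrow> 'b::topological_space^'n"
  assumes "\<And>i. continuous_on S (\<lambda>x. f x $ i)" shows "continuous_on S f"
  using continuous_on_vec_lambda[of S "\<lambda>i x. f x $ i"] assms by simp

lemma continuous_on_grad: "cont_diff f \<Longrightarrow> continuous_on UNIV (grad f)"
  by (rule continuous_on_vecI) (simp add: grad_def continuous_on_partial)

lemma cont_diff_grad: "Ck 2 f \<Longrightarrow> cont_diff (grad f)"
  by (rule cont_diff_vec) (simp add: grad_def Ck_2_imp_cont_diff_partial axis_in_Basis_iff)

lemma grad_diff:
  "cont_diff f \<Longrightarrow> cont_diff g \<Longrightarrow> grad (\<lambda>x. f x - g x) x = grad f x - grad g x"
  by (simp add: grad_def vec_eq_iff partial_deriv_diff)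

section \<open>Periodic functions and integration over the torus\<close>

text \<open>The gauge integral over the cube serves for all computations: for it, continuity of the
integrand (and of its parameter derivative) suffices to differentiate under the integral sign and to
exchange the order of integration. On continuous functions it agrees with the Lebesgue integral over the torus.\<close>

abbreviation tint :: "(real^'n \<Rightarrow> 'b::euclidean_space) \<Rightarrow> 'b" where
  "tint f \<equiv> integral (cbox 0 1) f"

lemma integrable_continuous_UNIV:
  fixes f :: "'a::euclidean_space \<Rightarrow> 'b::banach"
  shows "continuous_on UNIV f \<Longrightarrow> f integrable_on cbox a b"
  by (meson continuous_on_subset integrable_continuous subset_UNIV)

lemma torus_LINT_eq_tint:
  fixes f :: "real^'n \<Rightarrow> 'b::euclidean_space"
  assumes "continuous_on UNIV f"
  shows "integrable torus f" "(LINT x|torus. f x) = tint f"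
proof -
  show "integrable torus f"
    by (meson assms continuous_on_subset continuous_imp_integrable subset_UNIV)
  then show "(LINT x|torus. f x) = tint f"
    by (rule lebesgue_integral_eq_integral) simp
qed

lemma tint_const: "tint (\<lambda>x::real^'n. c::real) = c"
proof -
  have "measure lborel (cbox 0 (1::real^'n)) = 1"
    by (subst content_cbox_cart) (auto simp: interval_eq_empty_cart)
  then show ?thesis by simp
qed

lemma tint_mono:
  fixes f g :: "real^'n \<Rightarrow> real"
  assumes "continuous_on UNIV f" "continuous_on UNIV g" "\<And>x. x \<in> cbox 0 1 \<Longrightarrow> f x \<le> g x"
  shows "tint f \<le> tint g"
  using assms by (intro integral_le integrable_continuous_UNIV) auto

lemma tint_nonneg:
  fixes f :: "real^'n \<Rightarrow> real"
  assumes "continuous_on UNIV f" "\<And>x. x \<in> cbox 0 1 \<Longrightarrow> f x \<ge> 0"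
  shows "tint f \<ge> 0"
  using assms by (intro integral_nonneg integrable_continuous_UNIV) auto

lemma tint_add:
  fixes f g :: "real^'n \<Rightarrow> real"
  assumes "continuous_on UNIV f" "continuous_on UNIV g"
  shows "tint (\<lambda>x. f x + g x) = tint f + tint g"
  using assms by (intro integral_add integrable_continuous_UNIV)

lemma tint_diff:
  fixes f g :: "real^'n \<Rightarrow> real"
  assumes "continuous_on UNIV f" "continuous_on UNIV g"
  shows "tint (\<lambda>x. f x - g x) = tint f - tint g"
  using assms by (intro integral_diff integrable_continuous_UNIV)

lemma periodicD: "periodic f \<Longrightarrow> f (x + axis i 1) = f x"
  by (simp add: periodic_def)

lemma periodic_int_shift:
  assumes "periodic f"
  shows "f (x + of_int k *\<^sub>R axis i 1) = f x"
proof -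
  have nat: "f (x + real n *\<^sub>R axis i 1) = f x" for x n
  proof (induction n)
    case (Suc n)
    have "x + real (Suc n) *\<^sub>R axis i 1 = (x + real n *\<^sub>R axis i 1) + axis i 1"
      by (simp add: algebra_simps)
    then show ?case by (simp only: Suc periodicD[OF assms])
  qed simp
  show ?thesis
  proof (cases k)
    case (nonneg n)
    then show ?thesis using nat by simp
  next
    case (neg n)
    then have "f (x + of_int k *\<^sub>R axis i 1) = f ((x + of_int k *\<^sub>R axis i 1) + real (Suc n) *\<^sub>R axis i 1)"
      using nat by metis
    also have "(x + of_int k *\<^sub>R axis i 1) + real (Suc n) *\<^sub>R axis i 1 = x"
    proof -
      have "of_int k = - real (Suc n)" using neg by simp
      then show ?thesis by (simp flip: scaleR_left.add add: add.assoc)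
    qed
    finally show ?thesis .
  qed
qed

text \<open>Subtracting the integer part of every coordinate moves a point into the unit cube; compactness of
the cube then makes continuous periodic functions bounded.\<close>

lemma periodic_representative:
  fixes f :: "real^'n \<Rightarrow> 'b"
  assumes "periodic f"
  obtains y where "y \<in> cbox 0 1" "f y = f x"
proof -
  have *: "f (x + (\<Sum>i\<in>S. of_int (k i) *\<^sub>R axis i 1)) = f x" for S and k :: "'n \<Rightarrow> int" and x
  proof (induction S arbitrary: x rule: infinite_finite_induct)
    case (insert i S)
    have "x + (\<Sum>i\<in>insert i S. of_int (k i) *\<^sub>R axis i 1)
        = (x + (\<Sum>i\<in>S. of_int (k i) *\<^sub>R axis i 1)) + of_int (k i) *\<^sub>R axis i 1"
      using insert by (simp add: algebra_simps)
    then show ?case by (simp only: insert.IH periodic_int_shift[OF assms])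
  qed auto
  let ?y = "x + (\<Sum>i\<in>UNIV. of_int (- \<lfloor>x $ i\<rfloor>) *\<^sub>R axis i 1)"
  have "(\<Sum>i\<in>UNIV. of_int (- \<lfloor>x $ i\<rfloor>) *\<^sub>R (axis i 1 :: real^'n)) $ j = - of_int \<lfloor>x $ j\<rfloor>" for j
    by (simp add: sum_component axis_def if_distrib cong: if_cong)
  then have "?y $ j = x $ j - of_int \<lfloor>x $ j\<rfloor>" for j by simp
  then have "?y \<in> cbox 0 1" unfolding mem_box_cart
    by (simp; intro allI conjI; linarith)
  then show ?thesis using that *[where k = "\<lambda>i. - \<lfloor>x $ i\<rfloor>"] by blast
qed

lemma periodic_bounded:
  fixes f :: "real^'n \<Rightarrow> 'b::real_normed_vector"
  assumes "periodic f" "continuous_on UNIV f"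
  obtains B where "\<And>x. norm (f x) \<le> B"
proof -
  have "bounded (f ` cbox 0 1)"
    by (meson assms(2) compact_cbox compact_continuous_image compact_imp_bounded continuous_on_subset subset_UNIV)
  then obtain B where "\<And>y. y \<in> cbox 0 1 \<Longrightarrow> norm (f y) \<le> B"
    by (auto simp: bounded_iff)
  then show ?thesis using that periodic_representative[OF assms(1)] by metis
qed

lemma periodic_grad:
  assumes "periodic f" "cont_diff f"
  shows "periodic (grad f)"
proof -
  have "partial_deriv b f (x + axis i 1) = partial_deriv b f x" for b x i
  proof -
    have "((\<lambda>y. f (y + axis i 1)) has_derivative (\<lambda>h. frechet_derivative f (at (x + axis i 1)) h)) (at x)"
      by (rule has_derivative_compose[where f = "\<lambda>y. y + axis i 1" and f' = "\<lambda>h. h"])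
        (auto intro!: derivative_eq_intros cont_diff_has_derivative assms)
    then have "frechet_derivative f (at x) = frechet_derivative f (at (x + axis i 1))"
      using periodicD[OF assms(1)] by (simp add: frechet_derivative_eqI)
    then show ?thesis by (simp add: partial_deriv_def)
  qed
  then show ?thesis by (simp add: periodic_def grad_def)
qed

section \<open>Translation invariance and integration by parts on the torus\<close>

text \<open>Shifting the cube by \<open>s\<close> along an axis moves the slab \<open>{x. x\<^sub>i \<le> s}\<close> of the cube to the opposite face,
at distance one, where a periodic function takes the same values.\<close>

lemma tint_shift_axis:
  fixes f :: "real^'n \<Rightarrow> 'b::euclidean_space"
  assumes per: "periodic f" and cont: "continuous_on UNIV f" and s: "0 \<le> s" "s \<le> 1"
  shows "tint (\<lambda>x. f (x + s *\<^sub>R axis i 1)) = tint f"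
proof -
  let ?e = "axis i 1 :: real^'n"
  note int = integrable_continuous_UNIV[OF cont]
  have e: "?e \<in> Basis" by (simp add: axis_in_Basis_iff)
  have e_comp: "?e $ j = (if j = i then 1 else 0)" for j by (simp add: axis_def)
  have mem: "x \<in> cbox a b \<longleftrightarrow> (a $ i \<le> x $ i \<and> x $ i \<le> b $ i) \<and>
      (\<forall>j. j \<noteq> i \<longrightarrow> a $ j \<le> x $ j \<and> x $ j \<le> b $ j)" for x a b :: "real^'n"
    unfolding mem_box_cart by (metis (full_types))
  have "tint (\<lambda>x. f (x + s *\<^sub>R ?e)) = integral (cbox (s *\<^sub>R ?e) (1 + s *\<^sub>R ?e)) f"
    using integral_shift_cbox[of "s *\<^sub>R ?e" "s *\<^sub>R ?e" "1 + s *\<^sub>R ?e" f] by simp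
  also have "\<dots> = integral (cbox (s *\<^sub>R ?e) (1 + s *\<^sub>R ?e) \<inter> {x. x \<bullet> ?e \<le> 1}) f
      + integral (cbox (s *\<^sub>R ?e) (1 + s *\<^sub>R ?e) \<inter> {x. x \<bullet> ?e \<ge> 1}) f"
    by (rule integral_split[OF int e])
  \<comment> \<open>The part beyond the face \<open>x\<^sub>i = 1\<close> is translated back by one period.\<close>
  also have "cbox (s *\<^sub>R ?e) (1 + s *\<^sub>R ?e) \<inter> {x. x \<bullet> ?e \<le> 1} = cbox (s *\<^sub>R ?e) 1"
    using s by (auto simp: mem e_comp inner_axis)
  also have "cbox (s *\<^sub>R ?e) (1 + s *\<^sub>R ?e) \<inter> {x. x \<bullet> ?e \<ge> 1} = cbox ?e (1 + s *\<^sub>R ?e)"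
    using s by (auto simp: mem e_comp inner_axis)
  also have "integral (cbox ?e (1 + s *\<^sub>R ?e)) f = integral (cbox 0 (1 + (s - 1) *\<^sub>R ?e)) f"
    using integral_shift_cbox[of ?e ?e "1 + s *\<^sub>R ?e" f]
    by (simp add: periodicD[OF per] algebra_simps)
  also have "cbox (s *\<^sub>R ?e) 1 = cbox 0 1 \<inter> {x. x \<bullet> ?e \<ge> s}"
    using s by (auto simp: mem e_comp inner_axis)
  also have "cbox 0 (1 + (s - 1) *\<^sub>R ?e) = cbox 0 1 \<inter> {x. x \<bullet> ?e \<le> s}"
    using s by (auto simp: mem e_comp inner_axis)
  also have "integral (cbox 0 1 \<inter> {x. x \<bullet> ?e \<ge> s}) f + integral (cbox 0 1 \<inter> {x. x \<bullet> ?e \<le> s}) f = tint f"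
    using integral_split[OF int e, of 0 1 s] by simp
  finally show ?thesis .
qed

lemma tint_shift:
  fixes f :: "real^'n \<Rightarrow> 'b::euclidean_space"
  assumes per: "periodic f" and cont: "continuous_on UNIV f" and z: "z \<in> cbox 0 1"
  shows "tint (\<lambda>x. f (x + z)) = tint f"
proof -
  have "tint (\<lambda>x. f (x + (\<Sum>i\<in>S. (z $ i) *\<^sub>R axis i 1))) = tint f" for S
  proof (induction S rule: infinite_finite_induct)
    case (insert i S)
    let ?g = "\<lambda>x. f (x + (\<Sum>i\<in>S. (z $ i) *\<^sub>R axis i 1))"
    have "tint (\<lambda>x. ?g (x + (z $ i) *\<^sub>R axis i 1)) = tint ?g"
    proof (rule tint_shift_axis)
      have "f (x + axis j 1 + (\<Sum>i\<in>S. (z $ i) *\<^sub>R axis i 1)) = ?g x" for x j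
        using periodicD[OF per, of "x + (\<Sum>i\<in>S. (z $ i) *\<^sub>R axis i 1)" j] by (simp add: algebra_simps)
      then show "periodic ?g" by (simp add: periodic_def)
      show "continuous_on UNIV ?g"
        by (rule continuous_on_compose2[OF cont]) (auto intro!: continuous_intros)
    qed (use z in \<open>auto simp: mem_box_cart\<close>)
    then show ?case using insert by (simp add: add_ac)
  qed auto
  from this[of UNIV] show ?thesis
    using basis_expansion[of z] by (simp add: scalar_mult_eq_scaleR)
qed

text \<open>The integral of \<open>x \<mapsto> g (x + s *\<^sub>R e\<^sub>i)\<close> does not depend on \<open>s\<close>; its derivative at \<open>s = 0\<close>,
taken under the integral sign, is the integral of the partial derivative.\<close>

lemma tint_partial_deriv_eq_0:
  fixes g :: "real^'n \<Rightarrow> real"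
  assumes per: "periodic g" and g: "cont_diff g"
  shows "tint (partial_deriv (axis i 1) g) = 0"
proof -
  let ?e = "axis i 1 :: real^'n"
  have "((\<lambda>s. tint (\<lambda>x. g (x + s *\<^sub>R ?e))) has_field_derivative
      tint (\<lambda>x. partial_deriv ?e g (x + 0 *\<^sub>R ?e))) (at 0 within {0..1})"
  proof (rule leibniz_rule_field_derivative)
    show "((\<lambda>s. g (x + s *\<^sub>R ?e)) has_field_derivative partial_deriv ?e g (x + s *\<^sub>R ?e)) (at s within {0..1})"
      for s :: real and x
    proof -
      have "((\<lambda>s. g (x + s *\<^sub>R ?e)) has_derivative (\<lambda>h. grad g (x + s *\<^sub>R ?e) \<bullet> (h *\<^sub>R ?e))) (at s within {0..1})"
        by (rule has_derivative_compose[OF _ has_derivative_grad[OF g]]) (auto intro!: derivative_eq_intros)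
      moreover have "(\<lambda>h. grad g (x + s *\<^sub>R ?e) \<bullet> (h *\<^sub>R ?e)) = (*) (partial_deriv ?e g (x + s *\<^sub>R ?e))"
        by (simp add: fun_eq_iff inner_axis grad_def)
      ultimately show ?thesis by (simp add: has_field_derivative_def)
    qed
    show "(\<lambda>x. g (x + s *\<^sub>R ?e)) integrable_on cbox 0 1" for s
      by (intro integrable_continuous_UNIV continuous_on_compose2[OF cont_diff_continuous[OF g]])
        (auto intro!: continuous_intros)
    show "continuous_on ({0..1} \<times> cbox 0 1) (\<lambda>(s, x). partial_deriv ?e g (x + s *\<^sub>R ?e))"
      unfolding split_beta
      by (intro continuous_on_compose2[OF continuous_on_partial[OF g]])
        (auto intro!: continuous_intros)
  qed auto
  moreover have "((\<lambda>s. tint (\<lambda>x. g (x + s *\<^sub>R ?e))) has_field_derivative 0) (at 0 within {0..1})"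
  proof (rule has_field_derivative_transform_within[of "\<lambda>_. tint g" _ _ _ 1])
    show "tint g = tint (\<lambda>x. g (x + s *\<^sub>R ?e))" if "s \<in> {0..1}" for s
      using tint_shift_axis[OF per cont_diff_continuous[OF g], of s i] that by simp
  qed auto
  ultimately show ?thesis
    using vector_derivative_unique_within_closed_interval[of 0 1 0]
    by (fastforce simp: has_real_derivative_iff_has_vector_derivative)
qed

text \<open>The product rule expresses \<open>\<phi> * divergence F + F \<bullet> grad \<phi>\<close> as a sum of partial derivatives of periodic
functions; no boundary term remains.\<close>

lemma tint_divergence_by_parts:
  fixes \<phi> :: "real^'n \<Rightarrow> real" and F :: "real^'n \<Rightarrow> real^'n"
  assumes \<phi>: "periodic \<phi>" "cont_diff \<phi>" and F: "periodic F" "cont_diff F"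
  shows "tint (\<lambda>x. \<phi> x * divergence F x) = - tint (\<lambda>x. F x \<bullet> grad \<phi> x)"
proof -
  let ?d = "\<lambda>i. partial_deriv (axis i 1 :: real^'n)"
  have Fi: "cont_diff (\<lambda>x. F x $ i)" for i using F(2) by (rule cont_diff_component)
  note [continuous_intros] = continuous_on_partial[OF Fi] continuous_on_partial[OF \<phi>(2)]
    cont_diff_continuous[OF Fi] cont_diff_continuous[OF \<phi>(2)]
  have "0 = (\<Sum>i\<in>UNIV. tint (?d i (\<lambda>x. \<phi> x * F x $ i)))"
    using \<phi> F by (subst tint_partial_deriv_eq_0) (auto simp: periodic_def intro!: cont_diff_mult Fi)
  also have "\<dots> = tint (\<lambda>x. \<Sum>i\<in>UNIV. ?d i (\<lambda>x. \<phi> x * F x $ i) x)"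
    by (rule integral_sum[symmetric])
      (auto intro!: integrable_continuous_UNIV continuous_on_partial cont_diff_mult \<phi> Fi)
  also have "\<dots> = tint (\<lambda>x. \<phi> x * divergence F x + F x \<bullet> grad \<phi> x)"
    by (intro arg_cong[of _ _ tint] ext)
      (simp add: partial_deriv_mult[OF \<phi>(2) Fi] divergence_def grad_def inner_vec_def
        sum.distrib sum_distrib_left mult.commute)
  also have "\<dots> = tint (\<lambda>x. \<phi> x * divergence F x) + tint (\<lambda>x. F x \<bullet> grad \<phi> x)"
  proof (rule integral_add; rule integrable_continuous_UNIV)
    show "continuous_on UNIV (\<lambda>x. \<phi> x * divergence F x)"
      unfolding divergence_def by (intro continuous_intros)
    show "continuous_on UNIV (\<lambda>x. F x \<bullet> grad \<phi> x)"
      by (intro continuous_intros cont_diff_continuous continuous_on_grad \<phi> F)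
  qed
  finally show ?thesis by simp
qed

section \<open>The Poincare inequality on the torus\<close>

text \<open>The variance of \<open>f\<close> over the unit interval is nonnegative.\<close>

lemma square_integral_le_integral_square:
  fixes f :: "real \<Rightarrow> real"
  assumes "continuous_on {0..1} f"
  shows "(integral {0..1} f)\<^sup>2 \<le> integral {0..1} (\<lambda>s. (f s)\<^sup>2)"
proof -
  define c where "c = integral {0..1} f"
  have f: "f integrable_on {0..1}" "(\<lambda>s. (f s)\<^sup>2) integrable_on {0..1}"
    using assms by (auto intro!: integrable_continuous_real continuous_intros)
  have "0 \<le> integral {0..1} (\<lambda>s. (f s - c)\<^sup>2)"
    using assms by (intro integral_nonneg integrable_continuous_real continuous_intros) auto
  also have "\<dots> = integral {0..1} (\<lambda>s. (f s)\<^sup>2 - (2 * c) * f s + c\<^sup>2)"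
    by (simp add: power2_eq_square algebra_simps)
  also have "\<dots> = integral {0..1} (\<lambda>s. (f s)\<^sup>2) - (2 * c) * integral {0..1} f + c\<^sup>2"
  proof -
    have "(\<lambda>s. (2 * c) * f s) integrable_on {0..1}"
      using f(1) by (rule integrable_on_mult_right)
    then show ?thesis
      using f by (subst integral_add) (auto simp: integrable_diff integral_diff)
  qed
  finally show ?thesis by (simp add: c_def power2_eq_square)
qed

lemma norm_le_of_mem_unit_cube:
  assumes "z \<in> cbox 0 (1::real^'n)"
  shows "(norm z)\<^sup>2 \<le> CARD('n)"
proof -
  have "(norm z)\<^sup>2 = (\<Sum>i\<in>UNIV. z $ i * z $ i)"
    by (simp add: power2_norm_eq_inner inner_vec_def)
  also have "\<dots> \<le> (\<Sum>i\<in>(UNIV::'n set). 1)"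
    using assms by (intro sum_mono mult_le_one) (auto simp: mem_box_cart)
  finally show ?thesis by simp
qed

text \<open>The increment \<open>w (x + z) - w x\<close> is the integral of \<open>grad w (x + s *\<^sub>R z) \<bullet> z\<close> over \<open>s \<in> [0, 1]\<close>. After
Cauchy-Schwarz, integrate in \<open>x\<close> first: each translate of \<open>|grad w|\<^sup>2\<close> has the same integral.
The constant is the squared diameter of the cube.\<close>

lemma periodic_increment_le:
  fixes w :: "real^'n \<Rightarrow> real"
  assumes per: "periodic w" and w: "cont_diff w" and z: "z \<in> cbox 0 1"
  shows "tint (\<lambda>x. (w (x + z) - w x)\<^sup>2) \<le> CARD('n) * tint (\<lambda>x. (norm (grad w x))\<^sup>2)"
proof -
  let ?G = "\<lambda>x. (norm (grad w x))\<^sup>2"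
  note [continuous_intros] = continuous_on_compose2[OF continuous_on_grad[OF w] _ subset_UNIV]
    continuous_on_compose2[OF cont_diff_continuous[OF w] _ subset_UNIV]
  have incr: "(w (x + z) - w x)\<^sup>2 \<le> CARD('n) * integral {0..1} (\<lambda>s. ?G (x + s *\<^sub>R z))" for x
  proof -
    have "((\<lambda>s. grad w (x + s *\<^sub>R z) \<bullet> z) has_integral (w (x + 1 *\<^sub>R z) - w (x + 0 *\<^sub>R z))) {0..1}"
    proof (rule fundamental_theorem_of_calculus)
      fix s :: real
      have "((\<lambda>s. w (x + s *\<^sub>R z)) has_derivative (\<lambda>h. grad w (x + s *\<^sub>R z) \<bullet> (h *\<^sub>R z))) (at s within {0..1})"
        by (rule has_derivative_compose[OF _ has_derivative_grad[OF w]]) (auto intro!: derivative_eq_intros)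
      then show "((\<lambda>s. w (x + s *\<^sub>R z)) has_vector_derivative grad w (x + s *\<^sub>R z) \<bullet> z) (at s within {0..1})"
        by (simp add: has_vector_derivative_def)
    qed simp
    then have "(w (x + z) - w x)\<^sup>2 = (integral {0..1} (\<lambda>s. grad w (x + s *\<^sub>R z) \<bullet> z))\<^sup>2"
      by (simp add: integral_unique)
    also have "\<dots> \<le> integral {0..1} (\<lambda>s. (grad w (x + s *\<^sub>R z) \<bullet> z)\<^sup>2)"
      by (intro square_integral_le_integral_square continuous_intros)
    also have "\<dots> \<le> integral {0..1} (\<lambda>s. CARD('n) * ?G (x + s *\<^sub>R z))"
    proof (intro integral_le integrable_continuous_real continuous_intros)
      fix s :: real
      have "(grad w (x + s *\<^sub>R z) \<bullet> z)\<^sup>2 \<le> ?G (x + s *\<^sub>R z) * (norm z)\<^sup>2"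
        using Cauchy_Schwarz_ineq[of "grad w (x + s *\<^sub>R z)" z] by (simp add: power2_norm_eq_inner)
      also have "\<dots> \<le> ?G (x + s *\<^sub>R z) * CARD('n)"
        by (intro mult_left_mono norm_le_of_mem_unit_cube z) auto
      finally show "(grad w (x + s *\<^sub>R z) \<bullet> z)\<^sup>2 \<le> CARD('n) * ?G (x + s *\<^sub>R z)"
        by (simp add: mult.commute)
    qed
    finally show ?thesis by simp
  qed
  have inner: "tint (\<lambda>x. ?G (x + s *\<^sub>R z)) = tint ?G" if "s \<in> {0..1}" for s
  proof (rule tint_shift)
    show "periodic ?G" using periodic_grad[OF per w] by (simp add: periodic_def)
    show "continuous_on UNIV ?G" by (intro continuous_intros)
    show "s *\<^sub>R z \<in> cbox 0 1"
      using that z by (auto simp: mem_box_cart intro: mult_le_one)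
  qed
  have cont: "continuous_on UNIV (\<lambda>x. integral (cbox 0 1) (\<lambda>s::real. ?G (x + s *\<^sub>R z)))"
    by (rule integral_continuous_on_param) (auto simp: split_beta intro!: continuous_intros)
  have "tint (\<lambda>x. (w (x + z) - w x)\<^sup>2) \<le> tint (\<lambda>x. CARD('n) * integral (cbox 0 1) (\<lambda>s::real. ?G (x + s *\<^sub>R z)))"
    using incr by (intro tint_mono continuous_intros cont) auto
  also have "\<dots> = CARD('n) * tint (\<lambda>x. integral (cbox 0 1) (\<lambda>s::real. ?G (x + s *\<^sub>R z)))"
    by simp
  also have "tint (\<lambda>x. integral (cbox 0 1) (\<lambda>s::real. ?G (x + s *\<^sub>R z)))
      = integral (cbox 0 1) (\<lambda>s::real. tint (\<lambda>x. ?G (x + s *\<^sub>R z)))"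
    by (rule integral_swap_continuous) (auto simp: split_beta intro!: continuous_intros)
  also have "\<dots> = integral (cbox 0 1) (\<lambda>s::real. tint ?G)"
    by (rule integral_cong) (use inner in auto)
  finally show ?thesis by simp
qed

text \<open>Average the previous estimate over \<open>z\<close> in the cube. Expanding the square of the increment, the two
square terms each contribute \<open>\<integral> w\<^sup>2\<close> by translation invariance, and the mixed term vanishes because every
translate of \<open>w\<close> has mean zero.\<close>

lemma poincare_torus:
  fixes w :: "real^'n \<Rightarrow> real"
  assumes per: "periodic w" and w: "cont_diff w" and mean: "tint w = 0"
  shows "2 * tint (\<lambda>x. (w x)\<^sup>2) \<le> CARD('n) * tint (\<lambda>x. (norm (grad w x))\<^sup>2)"
proof -
  note cw = cont_diff_continuous[OF w]
  note [continuous_intros] = continuous_on_compose2[OF cw _ subset_UNIV]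
  define I where "I z = tint (\<lambda>x. (w (x + z) - w x)\<^sup>2)" for z
  define J where "J z = tint (\<lambda>x. w x * w (x + z))" for z
  \<comment> \<open>\<open>J\<close> is the autocorrelation of \<open>w\<close>, the mixed term of the squared increment.\<close>
  have cJ: "continuous_on UNIV J"
    unfolding J_def by (rule integral_continuous_on_param) (auto simp: split_beta intro!: continuous_intros)
  have I_eq: "I z = 2 * tint (\<lambda>x. (w x)\<^sup>2) - 2 * J z" if "z \<in> cbox 0 1" for z
  proof -
    have "I z = tint (\<lambda>x. (w (x + z))\<^sup>2 + (w x)\<^sup>2 - 2 * (w x * w (x + z)))"
      unfolding I_def by (simp add: power2_eq_square algebra_simps)
    also have "\<dots> = tint (\<lambda>x. (w (x + z))\<^sup>2) + tint (\<lambda>x. (w x)\<^sup>2) - 2 * J z"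
      unfolding J_def by (subst tint_diff tint_add; (intro continuous_intros)?)+ simp
    also have "tint (\<lambda>x. (w (x + z))\<^sup>2) = tint (\<lambda>x. (w x)\<^sup>2)"
      by (rule tint_shift) (use per that in \<open>auto simp: periodic_def intro!: continuous_intros\<close>)
    finally show ?thesis by simp
  qed
  have "tint J = tint (\<lambda>x. tint (\<lambda>z. w x * w (x + z)))"
    unfolding J_def by (rule integral_swap_continuous) (auto simp: split_beta intro!: continuous_intros)
  also have "\<dots> = tint (\<lambda>x::real^'n. 0)"
  proof (rule integral_cong)
    fix x :: "real^'n" assume "x \<in> cbox 0 1"
    then have "tint (\<lambda>z. w (z + x)) = 0"
      using mean tint_shift[OF per cw] by simp
    then show "tint (\<lambda>z. w x * w (x + z)) = 0" by (simp add: add.commute)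
  qed
  finally have J: "tint J = 0" by simp
  have "2 * tint (\<lambda>x. (w x)\<^sup>2) = tint (\<lambda>z::real^'n. 2 * tint (\<lambda>x. (w x)\<^sup>2)) - 2 * tint J"
    by (simp only: tint_const J)
  also have "\<dots> = tint (\<lambda>z. 2 * tint (\<lambda>x. (w x)\<^sup>2) - 2 * J z)"
    by (subst tint_diff) (auto intro!: continuous_intros cJ)
  also have "\<dots> \<le> tint (\<lambda>z::real^'n. CARD('n) * tint (\<lambda>x. (norm (grad w x))\<^sup>2))"
    using I_eq periodic_increment_le[OF per w]
    by (intro tint_mono continuous_intros cJ) (auto simp: I_def)
  finally show ?thesis by (simp only: tint_const)
qed

section \<open>Continuously differentiable curves of functions\<close>

lemma Ck_torus_1_iff: "f \<in> Ck_torus 1 \<longleftrightarrow> periodic f \<and> cont_diff f"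
  by (simp only: Ck_torus_def mem_Collect_eq Ck_1_iff_cont_diff)

text \<open>The norms are suprema of real numbers, so they bound pointwise values only when these are bounded;
continuity and periodicity provide the bounds.\<close>

lemma C1_norm_dominates:
  assumes "f \<in> Ck_torus 1"
  shows "\<bar>f x\<bar> \<le> C1_norm f" "norm (grad f x) \<le> C1_norm f"
proof -
  have f: "periodic f" "cont_diff f" using assms Ck_torus_1_iff by blast+
  obtain A where "\<And>x. norm (f x) \<le> A" using periodic_bounded[OF f(1) cont_diff_continuous[OF f(2)]] by blast
  then have A: "bdd_above (range (\<lambda>x. \<bar>f x\<bar>))" by (auto intro!: bdd_aboveI[of _ A])
  obtain B where "\<And>x. norm (grad f x) \<le> B"
    using periodic_bounded[OF periodic_grad[OF f] continuous_on_grad[OF f(2)]] by blast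
  then have B: "bdd_above (range (\<lambda>x. norm (grad f x)))" by (auto intro!: bdd_aboveI[of _ B])
  have "\<bar>f x\<bar> \<le> (SUP x. \<bar>f x\<bar>)" "norm (grad f x) \<le> (SUP x. norm (grad f x))"
    by (auto intro: cSUP_upper A B)
  moreover have "0 \<le> \<bar>f x\<bar>" "0 \<le> norm (grad f x)" by auto
  ultimately show "\<bar>f x\<bar> \<le> C1_norm f" "norm (grad f x) \<le> C1_norm f"
    unfolding C1_norm_def by linarith+
qed

lemma Ck_2_iff: "Ck 2 f \<longleftrightarrow> cont_diff f \<and> (\<forall>b\<in>Basis. cont_diff (partial_deriv b f))"
proof -
  have "Ck 2 f \<longleftrightarrow> (\<forall>x. f differentiable at x) \<and> (\<forall>b\<in>Basis. Ck 1 (partial_deriv b f))"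
    by (simp add: numeral_2_eq_2)
  then show ?thesis
    using Ck_2_imp_cont_diff[of f] unfolding Ck_1_iff_cont_diff by (auto simp: cont_diff_def)
qed

lemma Ck_torus_2_iff:
  "f \<in> Ck_torus 2 \<longleftrightarrow> periodic f \<and> cont_diff f \<and> (\<forall>b\<in>Basis. cont_diff (partial_deriv b f))"
  by (simp add: Ck_torus_def Ck_2_iff)

lemma Ck_torus_2_imp_1: "f \<in> Ck_torus 2 \<Longrightarrow> f \<in> Ck_torus 1"
  unfolding Ck_torus_1_iff Ck_torus_2_iff by blast

lemma continuous_of_Ck_torus:
  fixes f :: "real^'n \<Rightarrow> real"
  shows
  "f \<in> Ck_torus 1 \<Longrightarrow> continuous_on UNIV f"
  "f \<in> Ck_torus 2 \<Longrightarrow> continuous_on UNIV f"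
  "f \<in> Ck_torus 2 \<Longrightarrow> continuous_on UNIV (grad f)"
  unfolding Ck_torus_1_iff Ck_torus_2_iff
  by (simp_all add: cont_diff_continuous continuous_on_grad)

lemma C2_norm_dominates:
  assumes "f \<in> Ck_torus 2"
  shows "\<bar>f x\<bar> \<le> C2_norm f" "norm (grad f x) \<le> C2_norm f"
proof -
  have f: "periodic f" "cont_diff f" and f2: "Ck 2 f"
    using assms by (auto simp: Ck_torus_def Ck_2_imp_cont_diff)
  have hess: "hessian f y $ i $ j = grad (\<lambda>y. grad f y $ j) y $ i" for y i j
    by (simp add: hessian_def grad_def[abs_def])
  have cd: "cont_diff (\<lambda>y. grad f y $ j)" for j
    by (rule cont_diff_component[OF cont_diff_grad[OF f2]])
  have per: "periodic (grad (\<lambda>y. grad f y $ j))" for j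
    using periodic_grad[OF f] by (intro periodic_grad cd) (simp add: periodic_def)
  have "periodic (hessian f)"
    using per by (simp add: periodic_def vec_eq_iff hess)
  moreover have "continuous_on UNIV (hessian f)"
  proof (intro continuous_on_vecI)
    show "continuous_on UNIV (\<lambda>x. hessian f x $ i $ j)" for i j
      unfolding hess by (intro continuous_intros continuous_on_grad cd)
  qed
  ultimately obtain B where "\<And>x. norm (hessian f x) \<le> B" using periodic_bounded by blast
  then have "bdd_above (range (\<lambda>x. norm (hessian f x)))" by (auto intro!: bdd_aboveI[of _ B])
  then have "norm (hessian f x) \<le> (SUP x. norm (hessian f x))" by (auto intro: cSUP_upper)
  then have "C1_norm f \<le> C2_norm f"
    unfolding C1_norm_def C2_norm_def using norm_ge_zero[of "hessian f x"] by linarith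
  then show "\<bar>f x\<bar> \<le> C2_norm f" "norm (grad f x) \<le> C2_norm f"
    using C1_norm_dominates[OF Ck_torus_2_imp_1[OF assms], of x] by linarith+
qed

lemma cont_diff_divide: "cont_diff f \<Longrightarrow> cont_diff (\<lambda>x. f x / c)" for f :: "_ \<Rightarrow> real"
  using cont_diff_mult[OF _ cont_diff_const, of f "inverse c"] by (simp add: divide_inverse)

text \<open>Difference quotients of a curve stay in the space, which is what makes their norms meaningful.\<close>

lemma Ck_torus_1_vector_space:
  assumes "f \<in> Ck_torus 1"
  shows "g \<in> Ck_torus 1 \<Longrightarrow> (\<lambda>x. f x - g x) \<in> Ck_torus 1" "(\<lambda>x. f x / c) \<in> Ck_torus 1"
  using assms unfolding Ck_torus_1_iff
  by (auto simp: periodic_def cont_diff_diff cont_diff_divide)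

lemma Ck_torus_2_vector_space:
  assumes f: "f \<in> Ck_torus 2"
  shows "g \<in> Ck_torus 2 \<Longrightarrow> (\<lambda>x. f x - g x) \<in> Ck_torus 2" "(\<lambda>x. f x / c) \<in> Ck_torus 2"
proof -
  have "partial_deriv b (\<lambda>x. f x - g x) = (\<lambda>x. partial_deriv b f x - partial_deriv b g x)"
    if "g \<in> Ck_torus 2" for b
    by (rule ext, rule partial_deriv_diff) (use that f in \<open>auto simp: Ck_torus_2_iff\<close>)
  then show "g \<in> Ck_torus 2 \<Longrightarrow> (\<lambda>x. f x - g x) \<in> Ck_torus 2"
    using f by (auto simp: Ck_torus_2_iff periodic_def cont_diff_diff)
  have "partial_deriv b (\<lambda>x. f x / c) = (\<lambda>x. partial_deriv b f x / c)" for b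
    by (rule ext, rule partial_deriv_divide) (use f in \<open>auto simp: Ck_torus_2_iff\<close>)
  then show "(\<lambda>x. f x / c) \<in> Ck_torus 2"
    using f by (auto simp: Ck_torus_2_iff periodic_def cont_diff_divide)
qed

text \<open>A curve that is continuous in the uniform norm and consists of continuous functions is continuous
in time and space together, which differentiation under the integral sign demands.\<close>

lemma continuous_on_joint:
  fixes g :: "real \<Rightarrow> 'a::metric_space \<Rightarrow> 'b::real_normed_vector"
  assumes unif: "\<And>t e. t \<in> S \<Longrightarrow> e > 0 \<Longrightarrow> \<forall>\<^sub>F s in at t within S. \<forall>x. norm (g s x - g t x) < e"
    and cont: "\<And>t. t \<in> S \<Longrightarrow> continuous_on UNIV (g t)"
  shows "continuous_on (S \<times> UNIV) (\<lambda>(t, x). g t x)"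
  unfolding continuous_on_iff
proof (intro ballI allI impI)
  fix p :: "real \<times> 'a" and e :: real
  assume p: "p \<in> S \<times> UNIV" and e: "e > 0"
  obtain t x where [simp]: "p = (t, x)" by force
  have t: "t \<in> S" using p by simp
  obtain d1 where d1: "d1 > 0" "\<And>s y. s \<in> S \<Longrightarrow> s \<noteq> t \<Longrightarrow> dist s t < d1 \<Longrightarrow> norm (g s y - g t y) < e / 2"
    using unif[OF t, of "e / 2"] e unfolding eventually_at by auto
  have d1': "norm (g s y - g t y) < e / 2" if "s \<in> S" "dist s t < d1" for s y
    using d1(2)[OF that(1) _ that(2)] e by (cases "s = t") auto
  obtain d2 where d2: "d2 > 0" "\<And>y. dist y x < d2 \<Longrightarrow> dist (g t y) (g t x) < e / 2"
    using cont[OF t, unfolded continuous_on_iff, rule_format, of x "e / 2"] e by auto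
  show "\<exists>d>0. \<forall>q\<in>S \<times> UNIV. dist q p < d \<longrightarrow>
      dist (case q of (t, x) \<Rightarrow> g t x) (case p of (t, x) \<Rightarrow> g t x) < e"
  proof (intro exI conjI ballI impI)
    show "min d1 d2 > 0" using d1 d2 by simp
    fix q assume q: "q \<in> S \<times> UNIV" "dist q p < min d1 d2"
    obtain s y where [simp]: "q = (s, y)" by force
    have "dist s t < d1" "dist y x < d2"
      using q dist_fst_le[of q p] dist_snd_le[of q p] by auto
    then have "dist (g s y) (g t y) < e / 2" "dist (g t y) (g t x) < e / 2"
      using d1' d2 q by (auto simp: dist_norm)
    then have "dist (g s y) (g t x) < e"
      using dist_triangle[of "g s y" "g t x" "g t y"] by linarith
    then show "dist (case q of (t, x) \<Rightarrow> g t x) (case p of (t, x) \<Rightarrow> g t x) < e" by simp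
  qed
qed

text \<open>Here \<open>L\<close> is either evaluation or the gradient: a linear operation on functions whose pointwise values
are bounded by the norm. Convergence of difference quotients in norm then turns into pointwise
differentiability in time and uniform convergence in space.\<close>

lemma C1_curve_dominated:
  fixes L :: "('a::metric_space \<Rightarrow> real) \<Rightarrow> 'a \<Rightarrow> 'b::real_normed_vector"
  assumes curve: "C1_curve Y N f f'"
    and diff: "\<And>g h. g \<in> Y \<Longrightarrow> h \<in> Y \<Longrightarrow> (\<lambda>x. g x - h x) \<in> Y"
    and divide: "\<And>g c. g \<in> Y \<Longrightarrow> (\<lambda>x. g x / c) \<in> Y"
    and L_diff: "\<And>g h x. g \<in> Y \<Longrightarrow> h \<in> Y \<Longrightarrow> L (\<lambda>x. g x - h x) x = L g x - L h x"
    and L_divide: "\<And>g c x. g \<in> Y \<Longrightarrow> L (\<lambda>x. g x / c) x = L g x /\<^sub>R c"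
    and dom: "\<And>g x. g \<in> Y \<Longrightarrow> norm (L g x) \<le> N g"
    and cont: "\<And>g. g \<in> Y \<Longrightarrow> continuous_on UNIV (L g)"
  shows "t \<ge> 0 \<Longrightarrow> ((\<lambda>s. L (f s) x) has_vector_derivative L (f' t) x) (at t within {0..})"
    and "continuous_on ({0..} \<times> UNIV) (\<lambda>(t, x). L (f t) x)"
    and "continuous_on ({0..} \<times> UNIV) (\<lambda>(t, x). L (f' t) x)"
proof -
  have Y: "f t \<in> Y" "f' t \<in> Y" if "t \<ge> 0" for t using curve that unfolding C1_curve_def by auto
  have pos: "\<forall>\<^sub>F s in at t within {0..}. s \<ge> 0 \<and> s \<noteq> t" for t :: real
    unfolding eventually_at by (auto intro: exI[of _ 1])
  have quot: "\<forall>\<^sub>F s in at t within {0..}. \<forall>x. norm ((L (f s) x - L (f t) x) /\<^sub>R (s - t) - L (f' t) x) < e"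
    if t: "t \<ge> 0" and e: "e > 0" for t e
  proof -
    have "\<forall>\<^sub>F s in at t within {0..}. N (\<lambda>x. (f s x - f t x) / (s - t) - f' t x) < e"
      using curve t e unfolding C1_curve_def by (auto intro: order_tendstoD)
    then show ?thesis using pos[of t]
    proof eventually_elim
      case (elim s)
      have d: "(\<lambda>x. f s x - f t x) \<in> Y" using elim t Y diff by blast
      have q: "(\<lambda>x. (f s x - f t x) / (s - t)) \<in> Y" using divide[OF d] .
      have mem: "(\<lambda>x. (f s x - f t x) / (s - t) - f' t x) \<in> Y"
        using diff[OF q Y(2)[OF t]] .
      have eq: "L (\<lambda>x. (f s x - f t x) / (s - t) - f' t x) x = (L (f s) x - L (f t) x) /\<^sub>R (s - t) - L (f' t) x" for x
        using L_diff[OF q Y(2)[OF t]] L_divide[OF d] L_diff[OF Y(1) Y(1)] elim t by simp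
      have "norm ((L (f s) x - L (f t) x) /\<^sub>R (s - t) - L (f' t) x)
          \<le> N (\<lambda>x. (f s x - f t x) / (s - t) - f' t x)" for x
        using dom[OF mem, of x] by (simp only: eq)
      then show ?case using elim(1) le_less_trans by blast
    qed
  qed
  show "((\<lambda>s. L (f s) x) has_vector_derivative L (f' t) x) (at t within {0..})" if t: "t \<ge> 0"
    unfolding has_vector_derivative_def has_derivative_within
  proof
    show "bounded_linear (\<lambda>h. h *\<^sub>R L (f' t) x)" by (rule bounded_linear_scaleR_left)
    show "((\<lambda>s. (1 / norm (s - t)) *\<^sub>R (L (f s) x - (L (f t) x + (s - t) *\<^sub>R L (f' t) x))) \<longlongrightarrow> 0) (at t within {0..})"
    proof (rule tendstoI)
      fix e :: real assume "e > 0"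
      from quot[OF t this] pos[of t]
      show "\<forall>\<^sub>F s in at t within {0..}. dist ((1 / norm (s - t)) *\<^sub>R (L (f s) x - (L (f t) x + (s - t) *\<^sub>R L (f' t) x))) 0 < e"
      proof eventually_elim
        case (elim s)
        have "L (f s) x - (L (f t) x + (s - t) *\<^sub>R L (f' t) x)
            = (s - t) *\<^sub>R ((L (f s) x - L (f t) x) /\<^sub>R (s - t) - L (f' t) x)"
          using elim by (simp add: scaleR_right_diff_distrib[of "s - t"] diff_diff_eq)
        then have "norm ((1 / norm (s - t)) *\<^sub>R (L (f s) x - (L (f t) x + (s - t) *\<^sub>R L (f' t) x)))
            = norm ((L (f s) x - L (f t) x) /\<^sub>R (s - t) - L (f' t) x)"
          using elim by simp
        then show ?case using elim by simp
      qed
    qed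
  qed
  show "continuous_on ({0..} \<times> UNIV) (\<lambda>(t, x). L (f t) x)"
  proof (rule continuous_on_joint)
    fix t e :: real assume "t \<in> {0..}" and e: "e > 0"
    then have t: "t \<ge> 0" by simp
    define B where "B = 1 + \<bar>N (f' t)\<bar>"
    have B: "B > 0" by (simp add: B_def)
    have "\<forall>\<^sub>F s in at t within {0..}. dist s t < e / B"
      using e B by (auto simp: eventually_at intro!: exI[of _ "e / B"])
    with quot[OF t zero_less_one] pos[of t]
    show "\<forall>\<^sub>F s in at t within {0..}. \<forall>x. norm (L (f s) x - L (f t) x) < e"
    proof eventually_elim
      case (elim s)
      show ?case
      proof
        fix x
        let ?q = "(L (f s) x - L (f t) x) /\<^sub>R (s - t)"
        have "norm ?q \<le> norm (?q - L (f' t) x) + norm (L (f' t) x)"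
          using norm_triangle_ineq[of "?q - L (f' t) x" "L (f' t) x"] by simp
        also have "\<dots> \<le> B"
          using elim(1)[rule_format, of x] dom[OF Y(2)[OF t], of x] unfolding B_def by linarith
        finally have "\<bar>s - t\<bar> * norm ?q \<le> \<bar>s - t\<bar> * B" by (simp add: mult_left_mono)
        also have "\<dots> < e" using elim(3) B by (simp add: dist_real_def pos_less_divide_eq)
        also have "\<bar>s - t\<bar> * norm ?q = norm ((s - t) *\<^sub>R ?q)"
          by (simp only: norm_scaleR real_norm_def)
        also have "(s - t) *\<^sub>R ?q = L (f s) x - L (f t) x" using elim(2) by simp
        finally show "norm (L (f s) x - L (f t) x) < e" .
      qed
    qed
  qed (use cont Y in auto)
  show "continuous_on ({0..} \<times> UNIV) (\<lambda>(t, x). L (f' t) x)"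
  proof (rule continuous_on_joint)
    fix t e :: real assume t: "t \<in> {0..}" and e: "e > 0"
    then have "\<forall>\<^sub>F s in at t within {0..}. N (\<lambda>x. f' s x - f' t x) < e"
      using curve unfolding C1_curve_def by (auto intro: order_tendstoD)
    then show "\<forall>\<^sub>F s in at t within {0..}. \<forall>x. norm (L (f' s) x - L (f' t) x) < e"
      using pos[of t]
    proof eventually_elim
      case (elim s)
      then have Ys: "f' s \<in> Y" "f' t \<in> Y" using t Y(2) by auto
      show ?case
        using dom[OF diff[OF Ys]] L_diff[OF Ys] elim(1) le_less_trans by fastforce
    qed
  qed (use cont Y in auto)
qed

lemma grad_divide: "cont_diff f \<Longrightarrow> grad (\<lambda>x. f x / c) x = grad f x /\<^sub>R c"
  by (simp add: grad_def vec_eq_iff partial_deriv_divide) (simp add: divide_inverse_commute)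

lemma C1_curve_C1:
  fixes f f' :: "real \<Rightarrow> real^'n \<Rightarrow> real"
  assumes "C1_curve (Ck_torus 1) C1_norm f f'"
  shows "t \<ge> 0 \<Longrightarrow> ((\<lambda>s. f s x) has_vector_derivative f' t x) (at t within {0..})"
    and "continuous_on ({0..} \<times> UNIV) (\<lambda>(t, x). f t x)"
    and "continuous_on ({0..} \<times> UNIV) (\<lambda>(t, x). f' t x)"
proof -
  have cont: "g \<in> Ck_torus 1 \<Longrightarrow> continuous_on UNIV g" for g :: "real^'n \<Rightarrow> real"
    using Ck_torus_1_iff cont_diff_continuous by blast
  note * = C1_curve_dominated[OF assms Ck_torus_1_vector_space, where L = "\<lambda>f. f", OF _ _ _ _ _ _ cont]
  show "t \<ge> 0 \<Longrightarrow> ((\<lambda>s. f s x) has_vector_derivative f' t x) (at t within {0..})"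
    by (rule *) (auto simp: C1_norm_dominates(1)[unfolded One_nat_def] divide_inverse_commute)
  show "continuous_on ({0..} \<times> UNIV) (\<lambda>(t, x). f t x)"
    by (rule *) (auto simp: C1_norm_dominates(1)[unfolded One_nat_def] divide_inverse_commute)
  show "continuous_on ({0..} \<times> UNIV) (\<lambda>(t, x). f' t x)"
    by (rule *) (auto simp: C1_norm_dominates(1)[unfolded One_nat_def] divide_inverse_commute)
qed

lemma C1_curve_C2:
  fixes f f' :: "real \<Rightarrow> real^'n \<Rightarrow> real"
  assumes "C1_curve (Ck_torus 2) C2_norm f f'"
  shows "t \<ge> 0 \<Longrightarrow> ((\<lambda>s. f s x) has_vector_derivative f' t x) (at t within {0..})"
    and "continuous_on ({0..} \<times> UNIV) (\<lambda>(t, x). f t x)"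
    and "continuous_on ({0..} \<times> UNIV) (\<lambda>(t, x). f' t x)"
    and "continuous_on ({0..} \<times> UNIV) (\<lambda>(t, x). grad (f t) x)"
proof -
  have cd: "g \<in> Ck_torus 2 \<Longrightarrow> cont_diff g" for g :: "real^'n \<Rightarrow> real"
    using Ck_torus_2_iff by blast
  then have cont: "g \<in> Ck_torus 2 \<Longrightarrow> continuous_on UNIV g" for g :: "real^'n \<Rightarrow> real"
    using cont_diff_continuous by blast
  note * = C1_curve_dominated[OF assms Ck_torus_2_vector_space, where L = "\<lambda>f. f", OF _ _ _ _ _ _ cont]
  show "t \<ge> 0 \<Longrightarrow> ((\<lambda>s. f s x) has_vector_derivative f' t x) (at t within {0..})"
    by (rule *) (auto simp: C2_norm_dominates(1) divide_inverse_commute)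
  show "continuous_on ({0..} \<times> UNIV) (\<lambda>(t, x). f t x)"
    by (rule *) (auto simp: C2_norm_dominates(1) divide_inverse_commute)
  show "continuous_on ({0..} \<times> UNIV) (\<lambda>(t, x). f' t x)"
    by (rule *) (auto simp: C2_norm_dominates(1) divide_inverse_commute)
  show "continuous_on ({0..} \<times> UNIV) (\<lambda>(t, x). grad (f t) x)"
    by (rule C1_curve_dominated(2)[OF assms Ck_torus_2_vector_space, where L = grad])
      (auto simp: C2_norm_dominates(2) grad_diff grad_divide cd continuous_on_grad)
qed

section \<open>Smooth convex Hamiltonians\<close>

text \<open>Taylor's formula of second order along the segment from \<open>p\<close> to \<open>q\<close>, with the remainder bounded below by
the Hessian condition. Two applications of monotonicity replace the integral remainder.\<close>

lemma quadratic_lower_bound: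
  fixes f :: "real^'n \<Rightarrow> real"
  assumes f: "cont_diff f" and f': "cont_diff (grad f)"
    and hess: "\<And>p \<xi>. (\<Sum>i\<in>UNIV. \<Sum>j\<in>UNIV. hessian f p $ i $ j * \<xi> $ i * \<xi> $ j) \<ge> \<rho> * (norm \<xi>)\<^sup>2"
  shows "f q - f p - grad f p \<bullet> (q - p) \<ge> \<rho> / 2 * (norm (q - p))\<^sup>2"
proof -
  define d where "d = q - p"
  define N where "N = (norm d)\<^sup>2"
  define Q where "Q s = (\<Sum>i\<in>UNIV. \<Sum>j\<in>UNIV. hessian f (p + s *\<^sub>R d) $ i $ j * d $ i * d $ j)" for s
  have line: "((\<lambda>s. p + s *\<^sub>R d) has_derivative (\<lambda>h. h *\<^sub>R d)) (at s)" for s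
    by (auto intro!: derivative_eq_intros)
  have g1: "((\<lambda>s. f (p + s *\<^sub>R d)) has_real_derivative grad f (p + s *\<^sub>R d) \<bullet> d) (at s)" for s
  proof -
    have "((\<lambda>s. f (p + s *\<^sub>R d)) has_derivative (\<lambda>h. grad f (p + s *\<^sub>R d) \<bullet> (h *\<^sub>R d))) (at s)"
      by (rule has_derivative_compose[OF line has_derivative_grad[OF f]])
    moreover have "(\<lambda>h. grad f (p + s *\<^sub>R d) \<bullet> (h *\<^sub>R d)) = (*) (grad f (p + s *\<^sub>R d) \<bullet> d)"
      by (simp add: fun_eq_iff)
    ultimately show ?thesis by (simp add: has_field_derivative_def)
  qed
  have comp: "cont_diff (\<lambda>y. grad f y $ j)" for j by (rule cont_diff_component[OF f'])
  have g2: "((\<lambda>s. grad f (p + s *\<^sub>R d) \<bullet> d) has_real_derivative Q s) (at s)" for s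
  proof -
    let ?D = "\<lambda>j. grad (\<lambda>y. grad f y $ j) (p + s *\<^sub>R d) \<bullet> d"
    have "((\<lambda>s. grad f (p + s *\<^sub>R d) $ j) has_real_derivative ?D j) (at s)" for j
    proof -
      have "((\<lambda>s. grad f (p + s *\<^sub>R d) $ j) has_derivative
          (\<lambda>h. grad (\<lambda>y. grad f y $ j) (p + s *\<^sub>R d) \<bullet> (h *\<^sub>R d))) (at s)"
        by (rule has_derivative_compose[OF line has_derivative_grad[OF comp]])
      moreover have "(\<lambda>h. grad (\<lambda>y. grad f y $ j) (p + s *\<^sub>R d) \<bullet> (h *\<^sub>R d)) = (*) (?D j)"
        by (simp add: fun_eq_iff)
      ultimately show ?thesis by (simp add: has_field_derivative_def)
    qed
    then have "((\<lambda>s. \<Sum>j\<in>UNIV. grad f (p + s *\<^sub>R d) $ j * d $ j) has_real_derivative (\<Sum>j\<in>UNIV. ?D j * d $ j)) (at s)"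
      by (intro DERIV_sum DERIV_cmult_right)
    moreover have "(\<Sum>j\<in>UNIV. ?D j * d $ j) = (\<Sum>j\<in>UNIV. \<Sum>i\<in>UNIV. hessian f (p + s *\<^sub>R d) $ i $ j * d $ i * d $ j)"
      by (simp add: inner_vec_def sum_distrib_right hessian_def grad_def[abs_def])
    moreover have "\<dots> = Q s" unfolding Q_def by (rule sum.swap)
    ultimately show ?thesis by (simp add: inner_vec_def)
  qed
  have Q: "Q s \<ge> \<rho> * N" for s unfolding Q_def N_def by (rule hess)
  \<comment> \<open>First monotonicity argument: the directional slope grows at rate at least \<open>\<rho> * N\<close>.\<close>
  have slope: "grad f p \<bullet> d \<le> grad f (p + s *\<^sub>R d) \<bullet> d - \<rho> * N * s" if "s \<ge> 0" for s
  proof -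
    have "grad f (p + 0 *\<^sub>R d) \<bullet> d - \<rho> * N * 0 \<le> grad f (p + s *\<^sub>R d) \<bullet> d - \<rho> * N * s"
      by (rule DERIV_nonneg_imp_nondecreasing[OF that, of "\<lambda>s. grad f (p + s *\<^sub>R d) \<bullet> d - \<rho> * N * s"])
        (use Q in \<open>auto intro!: exI derivative_eq_intros g2\<close>)
    then show ?thesis by simp
  qed
  let ?\<phi> = "\<lambda>s. f (p + s *\<^sub>R d) - s * (grad f p \<bullet> d) - \<rho> / 2 * N * s\<^sup>2"
  \<comment> \<open>Second one: \<open>?\<phi>\<close> is the function minus the quadratic it should dominate.\<close>
  have "?\<phi> 0 \<le> ?\<phi> 1"
  proof (rule DERIV_nonneg_imp_nondecreasing[of 0 1 ?\<phi>])
    fix s :: real assume "0 \<le> s"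
    moreover have "(?\<phi> has_real_derivative grad f (p + s *\<^sub>R d) \<bullet> d - grad f p \<bullet> d - \<rho> * N * s) (at s)"
      by (auto intro!: derivative_eq_intros g1)
    ultimately show "\<exists>y. (?\<phi> has_real_derivative y) (at s) \<and> 0 \<le> y"
      using slope by force
  qed simp
  then show ?thesis by (simp add: d_def N_def)
qed

text \<open>Smoothness is a hypothesis on \<open>H\<close> as a function of the pair \<open>(x, p)\<close>, whereas \<open>DpH\<close> freezes \<open>x\<close>. The
chain rule identifies its components with partial derivatives of the joint function in the
directions \<open>(0, axis i 1)\<close>; these are again continuously differentiable in both variables.\<close>

lemma smooth_hamiltonian_cont_diff:
  fixes H :: "real^'n \<Rightarrow> real^'n \<Rightarrow> real"
  assumes "smooth_hamiltonian H"
  shows "cont_diff (\<lambda>(x, p). H x p)" "cont_diff (\<lambda>(x, p). DpH H x p)"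
proof -
  let ?h = "\<lambda>(x, p). H x p"
  have h2: "Ck 2 ?h" using assms by (simp add: smooth_hamiltonian_def smooth_def)
  then show h: "cont_diff ?h" by (rule Ck_2_imp_cont_diff)
  have "DpH H x p $ i = partial_deriv (0, axis i 1) ?h (x, p)" for x p i
  proof -
    have "((\<lambda>q. ?h (x, q)) has_derivative (\<lambda>v. frechet_derivative ?h (at (x, p)) (0, v))) (at p)"
      by (rule has_derivative_compose[OF _ cont_diff_has_derivative[OF h]])
        (auto intro!: derivative_eq_intros)
    then have "frechet_derivative (H x) (at p) = (\<lambda>v. frechet_derivative ?h (at (x, p)) (0, v))"
      by (intro frechet_derivative_eqI) simp
    then show ?thesis by (simp add: DpH_def grad_def partial_deriv_def)
  qed
  then have "(\<lambda>z. (case z of (x, p) \<Rightarrow> DpH H x p) $ i) = partial_deriv (0, axis i 1) ?h" for i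
    by (simp add: fun_eq_iff)
  moreover have "cont_diff (partial_deriv (0, axis i 1) ?h)" for i
    by (rule Ck_2_imp_cont_diff_partial[OF h2]) (simp add: Basis_prod_def axis_in_Basis_iff)
  ultimately show "cont_diff (\<lambda>(x, p). DpH H x p)"
    by (intro cont_diff_vec) simp
qed

text \<open>Used with \<open>v x = P + grad u x\<close>, this makes the flux \<open>m * DpH\<close> differentiable, so that its divergence is
a genuine one and integration by parts applies.\<close>

lemma cont_diff_along_field:
  assumes "cont_diff (\<lambda>(x, p). \<Phi> x p)" "cont_diff v"
  shows "cont_diff (\<lambda>x. \<Phi> x (v x))"
proof -
  have "cont_diff (\<lambda>x. (x, v x))"
    by (intro cont_diff_Pair cont_diff_bounded_linear bounded_linear_ident assms(2))
  from cont_diff_compose[OF assms(1) this] show ?thesis by simp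
qed

lemma hamiltonian_convexity:
  fixes H :: "real^'n \<Rightarrow> real^'n \<Rightarrow> real"
  assumes "smooth_hamiltonian H"
    and "\<And>x p \<xi>. (\<Sum>i\<in>UNIV. \<Sum>j\<in>UNIV. D2ppH H x p $ i $ j * \<xi> $ i * \<xi> $ j) \<ge> \<rho> * (norm \<xi>)\<^sup>2"
  shows "H x q - H x p - DpH H x p \<bullet> (q - p) \<ge> \<rho> / 2 * (norm (q - p))\<^sup>2"
  unfolding DpH_def
proof (rule quadratic_lower_bound)
  have pair: "cont_diff (\<lambda>p. (x, p))"
    by (intro cont_diff_Pair cont_diff_bounded_linear bounded_linear_ident cont_diff_const)
  show "cont_diff (H x)"
    using cont_diff_compose[OF smooth_hamiltonian_cont_diff(1)[OF assms(1)] pair] by simp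
  show "cont_diff (grad (H x))"
    using cont_diff_compose[OF smooth_hamiltonian_cont_diff(2)[OF assms(1)] pair]
    by (simp add: DpH_def[abs_def])
qed (use assms(2) in \<open>simp add: D2ppH_def\<close>)

section \<open>Dissipation along a trajectory\<close>

text \<open>A nonnegative function cannot decrease at a rate bounded away from zero forever: if the rate \<open>D\<close>
stayed above \<open>1 / (i + 1)\<close> after time \<open>i\<close>, the function would be negative after a further time
\<open>(i + 1) * (V i + 1)\<close>.\<close>

lemma dissipation:
  fixes V D :: "real \<Rightarrow> real"
  assumes V: "\<And>t. t \<ge> 0 \<Longrightarrow> (V has_real_derivative - D t) (at t within {0..})"
    and D: "\<And>t. t \<ge> 0 \<Longrightarrow> D t \<ge> 0" and pos: "\<And>t. t \<ge> 0 \<Longrightarrow> V t \<ge> 0"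
  shows "0 \<le> s \<Longrightarrow> s \<le> t \<Longrightarrow> V t \<le> V s"
    and "\<exists>\<tau> :: nat \<Rightarrow> real. (\<forall>i. \<tau> i \<ge> 0) \<and> filterlim \<tau> at_top sequentially \<and> (\<lambda>i. D (\<tau> i)) \<longlonglongrightarrow> 0"
proof -
  have mvt: "\<exists>x\<in>{s<..<t}. V t - V s = - D x * (t - s)" if "0 \<le> s" "s < t" for s t
    using that by (intro mvt_simple has_field_derivative_imp_has_derivative
        has_field_derivative_subset[OF V]) auto
  show "V t \<le> V s" if st: "0 \<le> s" "s \<le> t"
  proof (cases "s = t")
    case False
    with mvt[of s t] st obtain x where "x > s" "V t - V s = - D x * (t - s)" by auto
    moreover have "D x * (t - s) \<ge> 0" using D[of x] \<open>x > s\<close> st by simp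
    ultimately show ?thesis by simp
  qed simp
  have "\<exists>t\<ge>real i. D t < 1 / real (Suc i)" for i
  proof (rule ccontr)
    assume "\<not> ?thesis"
    then have low: "D t \<ge> 1 / real (Suc i)" if "t \<ge> real i" for t using that by force
    define T where "T = real (Suc i) * (V (real i) + 1)"
    have T: "T > 0" using pos[of "real i"] by (simp add: T_def)
    then obtain x where x: "x > real i" "V (real i + T) - V (real i) = - D x * T"
      using mvt[of "real i" "real i + T"] by auto
    have "1 / real (Suc i) * T \<le> D x * T" using low[of x] x T by (intro mult_right_mono) auto
    moreover have "1 / real (Suc i) * T = V (real i) + 1"
      unfolding T_def by (simp del: of_nat_Suc)
    ultimately have "V (real i + T) \<le> -1" using x by simp
    then show False using pos[of "real i + T"] T by simp
  qed
  then obtain \<tau> where \<tau>: "\<And>i. \<tau> i \<ge> real i" "\<And>i. D (\<tau> i) < 1 / real (Suc i)" by metis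
  have nonneg: "\<tau> i \<ge> 0" for i using \<tau>(1)[of i] by (meson of_nat_0_le_iff order_trans)
  have "filterlim \<tau> at_top sequentially"
    by (rule filterlim_at_top_mono[OF filterlim_real_sequentially]) (simp add: \<tau>)
  moreover have "(\<lambda>i. D (\<tau> i)) \<longlonglongrightarrow> 0"
  proof (rule tendsto_sandwich[OF _ _ tendsto_const])
    show "(\<lambda>i. 1 / real (Suc i)) \<longlonglongrightarrow> 0"
      using LIMSEQ_Suc[OF lim_1_over_n] by simp
    show "\<forall>\<^sub>F i in sequentially. D (\<tau> i) \<le> 1 / real (Suc i)"
      by (intro always_eventually allI less_imp_le \<tau>(2))
  qed (auto intro!: always_eventually D nonneg)
  ultimately show "\<exists>\<tau> :: nat \<Rightarrow> real. (\<forall>i. \<tau> i \<ge> 0) \<and> filterlim \<tau> at_top sequentially \<and> (\<lambda>i. D (\<tau> i)) \<longlonglongrightarrow> 0"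
    using nonneg by blast
qed

section \<open>Convergence in Lebesgue and Sobolev norms\<close>

lemma in_Lp_continuous:
  fixes f :: "real^'n \<Rightarrow> 'b::euclidean_space"
  assumes "continuous_on UNIV f" "q > 0"
  shows "in_Lp q f"
proof -
  have "f \<in> borel_measurable torus"
    using torus_LINT_eq_tint(1)[OF assms(1)] by (rule borel_measurable_integrable)
  moreover have "continuous_on UNIV (\<lambda>x. norm (f x) powr q)"
    using assms by (intro continuous_on_powr' continuous_intros) auto
  ultimately show ?thesis unfolding in_Lp_def using torus_LINT_eq_tint(1) by blast
qed

lemma converges_L2I:
  fixes f :: "real^'n \<Rightarrow> 'b::euclidean_space"
  assumes ev: "\<forall>\<^sub>F s in F. continuous_on UNIV (fs s)" and f: "continuous_on UNIV f"
    and lim: "((\<lambda>s. tint (\<lambda>x. (norm (fs s x - f x))\<^sup>2)) \<longlongrightarrow> 0) F"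
  shows "converges_Lp 2 fs f F"
  unfolding converges_Lp_def
proof (intro conjI)
  show "\<forall>\<^sub>F s in F. in_Lp 2 (fs s)" using ev by eventually_elim (simp add: in_Lp_continuous)
  show "in_Lp 2 f" using f by (simp add: in_Lp_continuous)
  have "((\<lambda>s. sqrt (tint (\<lambda>x. (norm (fs s x - f x))\<^sup>2))) \<longlongrightarrow> 0) F"
    using tendsto_real_sqrt[OF lim] by simp
  then show "((\<lambda>s. Lp_norm 2 (\<lambda>x. fs s x - f x)) \<longlongrightarrow> 0) F"
  proof (rule Lim_transform_eventually)
    show "\<forall>\<^sub>F s in F. sqrt (tint (\<lambda>x. (norm (fs s x - f x))\<^sup>2)) = Lp_norm 2 (\<lambda>x. fs s x - f x)"
      using ev
    proof eventually_elim
      case (elim s)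
      have c: "continuous_on UNIV (\<lambda>x. (norm (fs s x - f x))\<^sup>2)" by (intro continuous_intros elim f)
      have "tint (\<lambda>x. (norm (fs s x - f x))\<^sup>2) \<ge> 0" by (rule tint_nonneg[OF c]) simp
      then show ?case by (simp add: Lp_norm_def torus_LINT_eq_tint(2)[OF c] powr_half_sqrt)
    qed
  qed
qed

lemma converges_L1I:
  fixes f :: "real^'n \<Rightarrow> real"
  assumes ev: "\<forall>\<^sub>F s in F. continuous_on UNIV (fs s)" and f: "continuous_on UNIV f"
    and lim: "((\<lambda>s. tint (\<lambda>x. \<bar>fs s x - f x\<bar>)) \<longlongrightarrow> 0) F"
  shows "converges_Lp 1 fs f F"
  unfolding converges_Lp_def
proof (intro conjI)
  show "\<forall>\<^sub>F s in F. in_Lp 1 (fs s)" using ev by eventually_elim (simp add: in_Lp_continuous)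
  show "in_Lp 1 f" using f by (simp add: in_Lp_continuous)
  show "((\<lambda>s. Lp_norm 1 (\<lambda>x. fs s x - f x)) \<longlongrightarrow> 0) F"
  proof (rule Lim_transform_eventually[OF lim])
    show "\<forall>\<^sub>F s in F. tint (\<lambda>x. \<bar>fs s x - f x\<bar>) = Lp_norm 1 (\<lambda>x. fs s x - f x)"
      using ev
    proof eventually_elim
      case (elim s)
      have c: "continuous_on UNIV (\<lambda>x. \<bar>fs s x - f x\<bar>)" by (intro continuous_intros elim f)
      have "tint (\<lambda>x. \<bar>fs s x - f x\<bar>) \<ge> 0" by (rule tint_nonneg[OF c]) simp
      then show ?case by (simp add: Lp_norm_def torus_LINT_eq_tint(2)[OF c])
    qed
  qed
qed

lemma has_weak_grad_classical:
  fixes f :: "real^'n \<Rightarrow> real"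
  assumes f: "periodic f" "cont_diff f"
  shows "has_weak_grad f (grad f)"
  unfolding has_weak_grad_def
proof (intro ballI allI)
  fix \<phi> :: "real^'n \<Rightarrow> real" and i
  assume "\<phi> \<in> smooth_torus"
  then have \<phi>: "periodic \<phi>" "cont_diff \<phi>"
    using Ck_1_iff_cont_diff by (auto simp: smooth_torus_def smooth_def simp del: Ck.simps)
  have c: "continuous_on UNIV (\<lambda>x. f x * partial_deriv (axis i 1) \<phi> x)"
      "continuous_on UNIV (\<lambda>x. grad f x $ i * \<phi> x)"
    by (intro continuous_intros cont_diff_continuous continuous_on_partial continuous_on_grad f \<phi>)+
  have "0 = tint (partial_deriv (axis i 1) (\<lambda>x. f x * \<phi> x))"
    using f \<phi> by (subst tint_partial_deriv_eq_0) (auto simp: periodic_def intro!: cont_diff_mult)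
  also have "\<dots> = tint (\<lambda>x. f x * partial_deriv (axis i 1) \<phi> x + grad f x $ i * \<phi> x)"
    by (intro arg_cong[of _ _ tint] ext) (simp add: partial_deriv_mult[OF f(2) \<phi>(2)] grad_def)
  also have "\<dots> = tint (\<lambda>x. f x * partial_deriv (axis i 1) \<phi> x) + tint (\<lambda>x. grad f x $ i * \<phi> x)"
    by (rule tint_add[OF c])
  finally show "(LINT x|torus. f x * partial_deriv (axis i 1) \<phi> x) = - (LINT x|torus. grad f x $ i * \<phi> x)"
    by (simp add: torus_LINT_eq_tint(2)[OF c(1)] torus_LINT_eq_tint(2)[OF c(2)])
qed

section \<open>Conservation laws and entropy inequalities\<close>

lemma tint_has_real_derivative:
  fixes f f' :: "real \<Rightarrow> real^'n \<Rightarrow> real"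
  assumes f: "\<And>t x. t \<ge> 0 \<Longrightarrow> ((\<lambda>s. f s x) has_real_derivative f' t x) (at t within {0..})"
    and cont: "\<And>t. t \<ge> 0 \<Longrightarrow> continuous_on UNIV (f t)"
    and cont': "continuous_on ({0..} \<times> UNIV) (\<lambda>(t, x). f' t x)"
    and t: "t \<ge> 0"
  shows "((\<lambda>t. tint (f t)) has_real_derivative tint (f' t)) (at t within {0..})"
proof (rule leibniz_rule_field_derivative)
  show "continuous_on ({0..} \<times> cbox 0 1) (\<lambda>(t, x). f' t x)"
    by (rule continuous_on_subset[OF cont']) auto
qed (use f t in \<open>auto intro!: integrable_continuous_UNIV cont\<close>)

text \<open>The conservation laws of the flow, for the mass of \<open>m\<close> and for the mean of \<open>u\<close>, are instances.\<close>

lemma constant_integral: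
  fixes f f' :: "real \<Rightarrow> real^'n \<Rightarrow> real"
  assumes f: "\<And>t x. t \<ge> 0 \<Longrightarrow> ((\<lambda>s. f s x) has_vector_derivative f' t x) (at t within {0..})"
    and cont: "\<And>t. t \<ge> 0 \<Longrightarrow> continuous_on UNIV (f t)"
    and cont': "continuous_on ({0..} \<times> UNIV) (\<lambda>(t, x). f' t x)"
    and zero: "\<And>t. t \<ge> 0 \<Longrightarrow> tint (f' t) = 0" and t: "t \<ge> 0"
  shows "tint (f t) = tint (f 0)"
proof -
  have "((\<lambda>t. tint (f t)) has_real_derivative 0) (at t within {0..})" if "t \<ge> 0" for t
    using tint_has_real_derivative[OF _ cont cont' that] f zero[OF that]
    by (simp add: has_real_derivative_iff_has_vector_derivative)
  then obtain c where "\<forall>t\<in>{0..}. tint (f t) = c"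
    using has_field_derivative_zero_constant[of "{0..}" "\<lambda>t. tint (f t)"] by auto
  then show ?thesis using t by simp
qed

lemma positive_bound_on_cube:
  fixes f :: "real^'n \<Rightarrow> real"
  assumes "continuous_on UNIV f" "\<And>x. f x > 0"
  obtains c where "c > 0" "\<And>x. x \<in> cbox 0 1 \<Longrightarrow> c \<le> f x"
proof -
  have "cbox 0 (1::real^'n) \<noteq> {}" by (auto simp: interval_eq_empty_cart)
  moreover have "continuous_on (cbox 0 1) f"
    by (rule continuous_on_subset[OF assms(1)]) simp
  ultimately obtain y where "\<forall>x\<in>cbox 0 1. f y \<le> f x"
    using continuous_attains_inf[OF compact_cbox] by blast
  then show ?thesis using that[of "f y"] assms(2) by simp
qed

lemma tint_pos:
  fixes f :: "real^'n \<Rightarrow> real"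
  assumes "continuous_on UNIV f" "\<And>x. f x > 0"
  shows "tint f > 0"
proof -
  obtain c where c: "c > 0" "\<And>x. x \<in> cbox 0 1 \<Longrightarrow> c \<le> f x"
    using positive_bound_on_cube[OF assms] by blast
  have "c = tint (\<lambda>x::real^'n. c)" by (simp only: tint_const)
  also have "\<dots> \<le> tint f" using assms(1) c by (intro tint_mono) auto
  finally show ?thesis using c by simp
qed

text \<open>Pointwise form of the bound of relative entropy from below by the squared Hellinger distance. It
is \<open>ln r \<le> r - 1\<close> at \<open>r = sqrt (b / a)\<close>. The terms \<open>b - a\<close> integrate to zero for densities of equal mass.\<close>

lemma entropy_ge_hellinger:
  fixes a b :: real
  assumes "a > 0" "b > 0"
  shows "(sqrt b - sqrt a)\<^sup>2 \<le> a * (ln a - ln b) - a + b"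
proof -
  define \<alpha> \<beta> where "\<alpha> = sqrt a" and "\<beta> = sqrt b"
  have pos: "\<alpha> > 0" "\<beta> > 0" and sq: "a = \<alpha>\<^sup>2" "b = \<beta>\<^sup>2" using assms by (auto simp: \<alpha>_def \<beta>_def)
  have "ln (\<beta> / \<alpha>) \<le> \<beta> / \<alpha> - 1" using pos by (intro ln_le_minus_one) simp
  then have "\<alpha>\<^sup>2 * ln (\<beta> / \<alpha>) \<le> \<alpha>\<^sup>2 * (\<beta> / \<alpha> - 1)" by (intro mult_left_mono) auto
  also have "\<dots> = \<alpha> * \<beta> - \<alpha>\<^sup>2" using pos by (simp add: field_simps power2_eq_square)
  finally have "\<alpha>\<^sup>2 * (ln \<beta> - ln \<alpha>) \<le> \<alpha> * \<beta> - \<alpha>\<^sup>2" using pos by (simp add: ln_div)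
  moreover have "ln a = 2 * ln \<alpha>" "ln b = 2 * ln \<beta>" using pos by (auto simp: sq ln_realpow)
  ultimately have "2 * (\<alpha>\<^sup>2 - \<alpha> * \<beta>) \<le> a * (ln a - ln b)"
    by (simp add: sq algebra_simps)
  moreover have "(sqrt b - sqrt a)\<^sup>2 = b + a - 2 * (\<alpha> * \<beta>)"
    unfolding \<alpha>_def[symmetric] \<beta>_def[symmetric] by (simp add: sq power2_eq_square algebra_simps)
  ultimately show ?thesis by (simp add: sq)
qed

text \<open>Young's inequality for the factorisation \<open>b - a = (sqrt b - sqrt a) (sqrt b + sqrt a)\<close>. Keeping the parameter
\<open>\<epsilon>\<close> free replaces the Cauchy-Schwarz inequality for integrals: it is chosen after integration.\<close>

lemma abs_diff_le_hellinger:
  fixes a b :: real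
  assumes "a > 0" "b > 0" "\<epsilon> > 0"
  shows "\<bar>b - a\<bar> \<le> (sqrt b - sqrt a)\<^sup>2 / (2 * \<epsilon>) + \<epsilon> * (a + b)"
proof -
  define \<alpha> \<beta> where "\<alpha> = sqrt a" and "\<beta> = sqrt b"
  have pos: "\<alpha> > 0" "\<beta> > 0" and sq: "a = \<alpha>\<^sup>2" "b = \<beta>\<^sup>2" using assms by (auto simp: \<alpha>_def \<beta>_def)
  define x where "x = \<bar>\<beta> - \<alpha>\<bar>"
  have "b - a = (\<beta> - \<alpha>) * (\<beta> + \<alpha>)" by (simp add: sq power2_eq_square algebra_simps)
  then have "\<bar>b - a\<bar> = x * (\<beta> + \<alpha>)" using pos by (simp add: abs_mult x_def)
  also have "\<dots> \<le> x\<^sup>2 / (2 * \<epsilon>) + \<epsilon> / 2 * (\<beta> + \<alpha>)\<^sup>2"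
  proof -
    have "0 \<le> (x - \<epsilon> * (\<beta> + \<alpha>))\<^sup>2" by simp
    then have "2 * \<epsilon> * (x * (\<beta> + \<alpha>)) \<le> x\<^sup>2 + \<epsilon>\<^sup>2 * (\<beta> + \<alpha>)\<^sup>2"
      by (simp add: power2_eq_square algebra_simps)
    then have "x * (\<beta> + \<alpha>) \<le> (x\<^sup>2 + \<epsilon>\<^sup>2 * (\<beta> + \<alpha>)\<^sup>2) / (2 * \<epsilon>)"
      using assms(3) by (simp add: pos_le_divide_eq mult.commute)
    also have "\<dots> = x\<^sup>2 / (2 * \<epsilon>) + \<epsilon> / 2 * (\<beta> + \<alpha>)\<^sup>2"
      using assms(3) by (simp add: add_divide_distrib power2_eq_square)
    finally show ?thesis .
  qed
  also have "(\<beta> + \<alpha>)\<^sup>2 \<le> 2 * (a + b)"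
    using sum_squares_bound[of \<alpha> \<beta>] by (simp add: sq power2_eq_square algebra_simps)
  finally have "\<bar>b - a\<bar> \<le> x\<^sup>2 / (2 * \<epsilon>) + \<epsilon> / 2 * (2 * (a + b))"
    using assms(3) by (simp add: mult_left_mono)
  then show ?thesis by (simp add: x_def \<alpha>_def \<beta>_def algebra_simps)
qed

lemma ln_product_nonneg: "a > 0 \<Longrightarrow> b > 0 \<Longrightarrow> (a - b) * (ln a - ln b) \<ge> 0" for a b :: real
  by (cases "a \<le> b") (auto simp: mult_nonpos_nonpos)

section \<open>The Lyapunov functional of the flow\<close>

definition flux ::
    "(real^'n \<Rightarrow> real^'n \<Rightarrow> real) \<Rightarrow> real^'n \<Rightarrow> (real^'n \<Rightarrow> real) \<Rightarrow> (real^'n \<Rightarrow> real) \<Rightarrow> real^'n \<Rightarrow> real^'n" where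
  "flux H P \<mu> v y = \<mu> y *\<^sub>R DpH H y (P + grad v y)"

lemma flux_regular:
  assumes ham: "smooth_hamiltonian H" and \<mu>: "\<mu> \<in> Ck_torus 1" and v: "v \<in> Ck_torus 2"
  shows "periodic (flux H P \<mu> v)" "cont_diff (flux H P \<mu> v)"
proof -
  have "H (x + axis i 1) = H x" for x i
    using ham by (auto simp: smooth_hamiltonian_def periodic_def)
  then have "DpH H (x + axis i 1) p = DpH H x p" for x i p by (simp add: DpH_def)
  moreover have "periodic \<mu>" "periodic (grad v)"
    using \<mu> v by (auto simp: Ck_torus_2_iff Ck_torus_1_iff[unfolded One_nat_def] intro!: periodic_grad)
  ultimately show "periodic (flux H P \<mu> v)" by (simp add: periodic_def flux_def)
  have "cont_diff (\<lambda>x. P + grad v x)"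
    using v by (intro cont_diff_add cont_diff_const cont_diff_grad) (simp add: Ck_torus_def)
  from cont_diff_along_field[OF smooth_hamiltonian_cont_diff(2)[OF ham] this]
  show "cont_diff (flux H P \<mu> v)"
    unfolding flux_def[abs_def] using \<mu> Ck_torus_1_iff by (intro cont_diff_scaleR) blast+
qed

text \<open>The time derivatives and the convexity constant, which the definitions of the flow and of strict
convexity quantify existentially, are fixed as parameters. The two signs in the equation for \<open>u\<close> are cancelled.\<close>

locale mean_field_flow =
  fixes k :: nat and P :: "real^'n" and H :: "real^'n \<Rightarrow> real^'n \<Rightarrow> real" and \<rho> :: real
    and m u m' u' :: "real \<Rightarrow> real^'n \<Rightarrow> real" and ms us :: "real^'n \<Rightarrow> real"
  assumes k: "k > 0" and ham: "smooth_hamiltonian H" and \<rho>: "\<rho> > 0"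
    and convex: "\<And>x p \<xi>. (\<Sum>i\<in>UNIV. \<Sum>j\<in>UNIV. D2ppH H x p $ i $ j * \<xi> $ i * \<xi> $ j) \<ge> \<rho> * (norm \<xi>)\<^sup>2"
    and m_curve: "C1_curve (Ck_torus 1) C1_norm m m'"
    and u_curve: "C1_curve (Ck_torus 2) C2_norm u u'"
    and m_pos: "\<And>t x. t \<ge> 0 \<Longrightarrow> m t x > 0"
    and m_eq: "\<And>t x. t \<ge> 0 \<Longrightarrow> m' t x = - (m t x * (- H x (P + grad (u t) x)
        + Hbar_flow k H P (m t) (u t) + 1 / real k * ln (m t x)))"
    and u_eq: "\<And>t x. t \<ge> 0 \<Longrightarrow> u' t x = divergence (flux H P (m t) (u t)) x"
    and mass_0: "tint (m 0) = 1" and mean_0: "tint (u 0) = 0"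
    and stationary: "stationary_solution k H P ms us" and mean_us: "tint us = 0"
begin

lemma ms_us_regular: "ms \<in> Ck_torus 1" "us \<in> Ck_torus 2"
  using stationary by (auto simp: stationary_solution_def smooth_torus_def smooth_def Ck_torus_def simp del: Ck.simps)

lemma ms_pos: "ms x > 0"
  using stationary by (simp add: stationary_solution_def)

lemma m_u_regular:
  assumes "t \<ge> 0" shows "m t \<in> Ck_torus 1" "u t \<in> Ck_torus 2" "m' t \<in> Ck_torus 1"
  using m_curve u_curve assms by (auto simp: C1_curve_def)

lemma continuous_Hamiltonian:
  "f \<in> Ck_torus 2 \<Longrightarrow> continuous_on UNIV (\<lambda>x. H x (P + grad f x))"
  "f \<in> Ck_torus 2 \<Longrightarrow> continuous_on UNIV (\<lambda>x. DpH H x (P + grad f x))"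
proof -
  assume f: "f \<in> Ck_torus 2"
  have "continuous_on UNIV (\<lambda>x. (x, P + grad f x))"
    by (intro continuous_intros continuous_of_Ck_torus f)
  from continuous_on_compose2[OF cont_diff_continuous[OF smooth_hamiltonian_cont_diff(1)[OF ham]] this]
    continuous_on_compose2[OF cont_diff_continuous[OF smooth_hamiltonian_cont_diff(2)[OF ham]] this]
  show "continuous_on UNIV (\<lambda>x. H x (P + grad f x))" "continuous_on UNIV (\<lambda>x. DpH H x (P + grad f x))"
    by simp_all
qed

lemma continuous_stationary:
  "continuous_on UNIV ms" "continuous_on UNIV us" "continuous_on UNIV (grad us)"
  "continuous_on UNIV (\<lambda>x. ln (ms x))"
  "continuous_on UNIV (\<lambda>x. H x (P + grad us x))" "continuous_on UNIV (\<lambda>x. DpH H x (P + grad us x))"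
  using ms_pos
  by (auto intro!: continuous_on_ln continuous_of_Ck_torus(1)[OF ms_us_regular(1)]
    continuous_of_Ck_torus(2,3)[OF ms_us_regular(2)] continuous_Hamiltonian ms_us_regular
    simp: less_imp_neq[THEN not_sym])

lemma continuous_flow:
  assumes "t \<ge> 0"
  shows "continuous_on UNIV (m t)" "continuous_on UNIV (u t)" "continuous_on UNIV (grad (u t))"
  "continuous_on UNIV (\<lambda>x. ln (m t x))" "continuous_on UNIV (m' t)"
  "continuous_on UNIV (\<lambda>x. H x (P + grad (u t) x))" "continuous_on UNIV (\<lambda>x. DpH H x (P + grad (u t) x))"
  using m_pos[OF assms]
  by (auto intro!: continuous_on_ln continuous_of_Ck_torus(1)[OF m_u_regular(1)[OF assms]]
    continuous_of_Ck_torus(1)[OF m_u_regular(3)[OF assms]]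
    continuous_of_Ck_torus(2,3)[OF m_u_regular(2)[OF assms]] continuous_Hamiltonian m_u_regular(2) assms
    simp: less_imp_neq[THEN not_sym])

text \<open>The normalising constant \<open>Hbar_flow\<close> is the quotient that makes this integral vanish.\<close>

lemma tint_m'_eq_0:
  assumes t: "t \<ge> 0"
  shows "tint (m' t) = 0"
proof -
  note [continuous_intros] = continuous_flow[OF t]
  define A where "A x = m t x * H x (P + grad (u t) x) - 1 / real k * m t x * ln (m t x)" for x
  have cA: "continuous_on UNIV A" unfolding A_def by (intro continuous_intros)
  have M: "tint (m t) > 0" by (intro tint_pos continuous_intros m_pos t)
  have Hb: "Hbar_flow k H P (m t) (u t) = tint A / tint (m t)"
    unfolding Hbar_flow_def torus_LINT_eq_tint(2)[OF cA, unfolded A_def]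
      torus_LINT_eq_tint(2)[OF continuous_flow(1)[OF t]] A_def ..
  have "tint (m' t) = tint (\<lambda>x. A x - Hbar_flow k H P (m t) (u t) * m t x)"
    by (intro arg_cong[of _ _ tint] ext) (simp add: m_eq[OF t] A_def algebra_simps)
  also have "\<dots> = tint A - Hbar_flow k H P (m t) (u t) * tint (m t)"
    by (subst tint_diff) (auto intro!: cA continuous_intros)
  also have "\<dots> = 0" using M by (simp add: Hb)
  finally show ?thesis .
qed

lemma mass: "t \<ge> 0 \<Longrightarrow> tint (m t) = 1"
  using constant_integral[OF C1_curve_C1(1)[OF m_curve] continuous_flow(1) C1_curve_C1(3)[OF m_curve] tint_m'_eq_0]
    mass_0 by simp

lemma flux_m_u_regular:
  assumes "t \<ge> 0"
  shows "periodic (flux H P (m t) (u t))" "cont_diff (flux H P (m t) (u t))"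
  by (intro flux_regular[OF ham] m_u_regular assms)+

lemma flux_stationary_regular: "periodic (flux H P ms us)" "cont_diff (flux H P ms us)"
  by (intro flux_regular[OF ham] ms_us_regular)+

lemma mean:
  assumes "t \<ge> 0"
  shows "tint (u t) = 0"
proof -
  have "tint (u' t) = 0" if t: "t \<ge> 0" for t
  proof -
    have "grad (\<lambda>x::real^'n. 1) x = 0" for x
      by (simp add: grad_def partial_deriv_def vec_eq_iff)
    then have "tint (\<lambda>x. 1 * divergence (flux H P (m t) (u t)) x) = 0"
      by (subst tint_divergence_by_parts) (auto simp: periodic_def[of "\<lambda>_. 1"] cont_diff_const flux_m_u_regular[OF t])
    moreover have "u' t = divergence (flux H P (m t) (u t))" using u_eq[OF t] by blast
    ultimately show ?thesis by simp
  qed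
  then show ?thesis
    using constant_integral[OF C1_curve_C2(1)[OF u_curve] continuous_flow(2) C1_curve_C2(3)[OF u_curve] _ assms]
      mean_0 by simp
qed

text \<open>The first stationary equation says \<open>m* = exp (k H) / exp (k Hbar)\<close>, and \<open>Hbar_stat\<close> is the constant that
normalises this Gibbs density.\<close>

lemma mass_stationary: "tint ms = 1"
proof -
  have c: "continuous_on UNIV (\<lambda>x. exp (real k * H x (P + grad us x)))"
    by (intro continuous_intros continuous_stationary)
  define Z where "Z = tint (\<lambda>x. exp (real k * H x (P + grad us x)))"
  have Z: "Z > 0" unfolding Z_def by (rule tint_pos[OF c]) simp
  have Hb: "Hbar_stat k H P us = 1 / real k * ln Z"
    unfolding Hbar_stat_def Z_def torus_LINT_eq_tint(2)[OF c] ..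
  have "ms x = exp (real k * H x (P + grad us x)) / Z" for x
  proof -
    have "H x (P + grad us x) = 1 / real k * ln Z + 1 / real k * ln (ms x)"
      using stationary Hb by (simp add: stationary_solution_def)
    then have "real k * H x (P + grad us x) = ln Z + ln (ms x)" using k by (simp add: field_simps)
    then show ?thesis using Z ms_pos[of x] by (simp add: exp_add)
  qed
  then have "ms = (\<lambda>x. exp (real k * H x (P + grad us x)) / Z)" by blast
  then have "tint ms = tint (\<lambda>x. exp (real k * H x (P + grad us x)) / Z)" by (rule arg_cong)
  also have "\<dots> = 1" using Z by (simp add: Z_def)
  finally show ?thesis .
qed

text \<open>The first summand is the relative entropy of \<open>m*\<close> with respect to \<open>m\<close>. Between densities of equal
mass it is the Bregman divergence of \<open>m ln m\<close>, whose Hessian \<open>1 / m\<close> is the metric that defines the flow in the \<open>m\<close> variable.\<close>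

definition lyapunov :: "real \<Rightarrow> real" where
  "lyapunov t = tint (\<lambda>x. ms x * (ln (ms x) - ln (m t x)) + (u t x - us x)\<^sup>2 / 2)"

definition bregman :: "real^'n \<Rightarrow> real^'n \<Rightarrow> real^'n \<Rightarrow> real" where
  "bregman x q p = H x q - H x p - DpH H x p \<bullet> (q - p)"

definition dissipation_density :: "real \<Rightarrow> real^'n \<Rightarrow> real" where
  "dissipation_density t x =
     m t x * bregman x (P + grad us x) (P + grad (u t) x)
     + ms x * bregman x (P + grad (u t) x) (P + grad us x)
     + 1 / real k * ((m t x - ms x) * (ln (m t x) - ln (ms x)))"

lemma bregman_ge: "bregman x q p \<ge> \<rho> / 2 * (norm (q - p))\<^sup>2"
  unfolding bregman_def by (rule hamiltonian_convexity[OF ham convex])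

lemma continuous_dissipation_density:
  assumes "t \<ge> 0" shows "continuous_on UNIV (dissipation_density t)"
  unfolding dissipation_density_def bregman_def
  by (intro continuous_intros continuous_flow[OF assms] continuous_stationary)

text \<open>Integration by parts moves the derivatives onto \<open>w = u - u*\<close>: the flux of the flow contributes
\<open>- F \<bullet> grad w\<close>, and the stationary flux, being divergence free, may be added as \<open>Fs \<bullet> grad w\<close> at no cost.
After this, the integrands agree pointwise with minus the dissipation density up to
\<open>- m' + c * (m - m*)\<close> with \<open>c\<close> constant in space, and both of these terms have integral zero since mass is conserved and
equal to that of \<open>m*\<close>.\<close>

lemma lyapunov_derivative:
  assumes t: "t \<ge> 0"
  shows "(lyapunov has_real_derivative - tint (dissipation_density t)) (at t within {0..})"
proof -
  let ?f' = "\<lambda>t x. - (ms x * m' t x / m t x) + (u t x - us x) * u' t x"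
  have "(lyapunov has_real_derivative tint (?f' t)) (at t within {0..})"
    unfolding lyapunov_def
  proof (rule tint_has_real_derivative)
    fix t :: real and x assume t: "t \<ge> 0"
    have "((\<lambda>s. m s x) has_real_derivative m' t x) (at t within {0..})"
      "((\<lambda>s. u s x) has_real_derivative u' t x) (at t within {0..})"
      using C1_curve_C1(1)[OF m_curve t] C1_curve_C2(1)[OF u_curve t]
      by (auto simp: has_real_derivative_iff_has_vector_derivative)
    then show "((\<lambda>s. ms x * (ln (ms x) - ln (m s x)) + (u s x - us x)\<^sup>2 / 2) has_real_derivative ?f' t x) (at t within {0..})"
      using m_pos[OF t] by (auto intro!: derivative_eq_intros simp: field_simps)
  next
    fix t :: real assume t: "t \<ge> 0"
    show "continuous_on UNIV (\<lambda>x. ms x * (ln (ms x) - ln (m t x)) + (u t x - us x)\<^sup>2 / 2)"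
      by (intro continuous_intros continuous_flow[OF t] continuous_stationary) simp
  next
    note [continuous_intros] =
      C1_curve_C1(2,3)[OF m_curve, unfolded split_beta] C1_curve_C2(2,3)[OF u_curve, unfolded split_beta]
      continuous_on_compose2[OF continuous_stationary(1) _ subset_UNIV]
      continuous_on_compose2[OF continuous_stationary(2) _ subset_UNIV]
    show "continuous_on ({0..} \<times> UNIV) (\<lambda>(t, x). ?f' t x)"
      unfolding split_beta using m_pos
      by (intro continuous_intros) (auto simp: less_imp_neq[THEN not_sym])
  qed fact
  also have "tint (?f' t) = - tint (dissipation_density t)"
  proof -
    define w where "w x = u t x - us x" for x
    define F where "F = flux H P (m t) (u t)"
    define Fs where "Fs = flux H P ms us"
    define c where "c = Hbar_stat k H P us - Hbar_flow k H P (m t) (u t)"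
    have w: "periodic w" "cont_diff w"
      using Ck_torus_2_vector_space(1)[OF m_u_regular(2)[OF t] ms_us_regular(2)]
      unfolding w_def[abs_def] Ck_torus_2_iff by auto
    have gw: "grad w x = grad (u t) x - grad us x" for x
      unfolding w_def[abs_def] using m_u_regular(2)[OF t] ms_us_regular(2) by (intro grad_diff) (auto simp: Ck_torus_2_iff)
    have F: "periodic F" "cont_diff F" and Fs: "periodic Fs" "cont_diff Fs"
      unfolding F_def Fs_def by (fact flux_m_u_regular[OF t] flux_stationary_regular)+
    note [continuous_intros] = continuous_flow[OF t] continuous_stationary
      cont_diff_continuous[OF w(2)] cont_diff_continuous[OF F(2)] cont_diff_continuous[OF Fs(2)]
      continuous_on_grad[OF w(2)] continuous_dissipation_density[OF t]
    have cdiv: "continuous_on UNIV (divergence F)"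
      unfolding divergence_def[abs_def]
      by (intro continuous_intros continuous_on_partial cont_diff_component F)
    have "divergence Fs x = 0" for x
      using stationary unfolding stationary_solution_def Fs_def flux_def[abs_def] by simp
    then have Fs_w: "tint (\<lambda>x. Fs x \<bullet> grad w x) = 0"
      using tint_divergence_by_parts[OF w Fs] by simp
    have F_w: "tint (\<lambda>x. w x * divergence F x) = - tint (\<lambda>x. F x \<bullet> grad w x)"
      by (rule tint_divergence_by_parts[OF w F])
    \<comment> \<open>The stationary equation eliminates \<open>H\<close> at \<open>u*\<close> in favour of \<open>ln m*\<close> and a constant.\<close>
    have pointwise: "- (ms x * m' t x / m t x) - F x \<bullet> grad w x + Fs x \<bullet> grad w x
        = - dissipation_density t x - m' t x + c * (m t x - ms x)" for x
    proof -
      define h hs l ls D Ds where "h = H x (P + grad (u t) x)" and "hs = H x (P + grad us x)"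
        and "l = ln (m t x) / real k" and "ls = ln (ms x) / real k"
        and "D = DpH H x (P + grad (u t) x) \<bullet> grad w x" and "Ds = DpH H x (P + grad us x) \<bullet> grad w x"
      have hs: "hs = Hbar_stat k H P us + ls"
        using stationary by (simp add: stationary_solution_def hs_def ls_def)
      have m': "m' t x = m t x * (h - Hbar_flow k H P (m t) (u t) - l)"
        using m_eq[OF t, of x] by (simp add: h_def l_def algebra_simps)
      have quot: "ms x * m' t x / m t x = ms x * (h - Hbar_flow k H P (m t) (u t) - l)"
        using m_pos[OF t, of x] by (simp add: m')
      have fl: "F x \<bullet> grad w x = m t x * D" "Fs x \<bullet> grad w x = ms x * Ds"
        by (simp_all add: F_def Fs_def flux_def D_def Ds_def)
      have "DpH H x (P + grad (u t) x) \<bullet> (grad us x - grad (u t) x) = - D"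
        unfolding D_def gw by (simp add: inner_diff_right)
      then have "dissipation_density t x = m t x * (hs - h + D) + ms x * (h - hs - Ds) + (m t x - ms x) * (l - ls)"
        unfolding dissipation_density_def bregman_def
        by (simp add: h_def hs_def Ds_def gw l_def ls_def right_diff_distrib diff_divide_distrib)
      then show ?thesis
        unfolding quot fl unfolding m' c_def hs by (simp add: algebra_simps)
    qed
    have q: "continuous_on UNIV (\<lambda>x. - (ms x * m' t x / m t x))"
      using m_pos[OF t] by (intro continuous_intros) (auto simp: less_imp_neq[THEN not_sym])
    have "tint (?f' t) = tint (\<lambda>x. - (ms x * m' t x / m t x)) + tint (\<lambda>x. w x * divergence F x)"
      unfolding w_def F_def u_eq[OF t, abs_def]
      by (rule tint_add[OF q]) (intro continuous_intros cdiv[unfolded F_def])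
    also have "\<dots> = tint (\<lambda>x. - (ms x * m' t x / m t x)) - tint (\<lambda>x. F x \<bullet> grad w x) + tint (\<lambda>x. Fs x \<bullet> grad w x)"
      by (simp add: F_w Fs_w)
    also have "\<dots> = tint (\<lambda>x. - (ms x * m' t x / m t x) - F x \<bullet> grad w x + Fs x \<bullet> grad w x)"
      by (simp add: tint_add tint_diff q continuous_intros)
    also have "\<dots> = tint (\<lambda>x. - dissipation_density t x - m' t x + c * (m t x - ms x))"
      by (simp only: pointwise)
    also have "\<dots> = tint (\<lambda>x. - dissipation_density t x) - tint (m' t) + c * (tint (m t) - tint ms)"
      by (simp add: tint_add tint_diff continuous_intros)
    also have "\<dots> = - tint (dissipation_density t)"
      by (simp add: tint_m'_eq_0[OF t] mass[OF t] mass_stationary)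
    finally show ?thesis .
  qed
  finally show ?thesis .
qed

lemma continuous_entropy:
  assumes t: "t \<ge> 0"
  shows "continuous_on UNIV (\<lambda>x. ms x * (ln (ms x) - ln (m t x)))"
    "continuous_on UNIV (\<lambda>x. (u t x - us x)\<^sup>2)"
    "continuous_on UNIV (\<lambda>x. (sqrt (m t x) - sqrt (ms x))\<^sup>2)"
    "continuous_on UNIV (\<lambda>x. (norm (grad (u t) x - grad us x))\<^sup>2)"
    "continuous_on UNIV (\<lambda>x. (m t x - ms x) * (ln (m t x) - ln (ms x)))"
  by (intro continuous_intros continuous_flow[OF t] continuous_stationary)+

lemma lyapunov_split:
  assumes t: "t \<ge> 0"
  shows "lyapunov t = tint (\<lambda>x. ms x * (ln (ms x) - ln (m t x))) + tint (\<lambda>x. (u t x - us x)\<^sup>2) / 2"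
  unfolding lyapunov_def
  by (subst tint_add) (auto intro!: continuous_entropy[OF t] continuous_intros continuous_flow[OF t] continuous_stationary)

text \<open>Masses are equal, so the linear terms of the pointwise inequality cancel on integration.\<close>

lemma hellinger_le_entropy:
  assumes t: "t \<ge> 0"
  shows "tint (\<lambda>x. (sqrt (m t x) - sqrt (ms x))\<^sup>2) \<le> tint (\<lambda>x. ms x * (ln (ms x) - ln (m t x)))"
proof -
  note [continuous_intros] = continuous_entropy[OF t] continuous_flow[OF t] continuous_stationary
  have "tint (\<lambda>x. (sqrt (m t x) - sqrt (ms x))\<^sup>2)
      \<le> tint (\<lambda>x. ms x * (ln (ms x) - ln (m t x)) - ms x + m t x)"
    by (intro tint_mono continuous_entropy[OF t] entropy_ge_hellinger m_pos[OF t] ms_pos) (intro continuous_intros)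
  also have "\<dots> = tint (\<lambda>x. ms x * (ln (ms x) - ln (m t x))) - tint ms + tint (m t)"
    by (simp add: tint_add tint_diff continuous_intros)
  finally show ?thesis by (simp add: mass[OF t] mass_stationary)
qed

text \<open>The right-hand side is the sum of the two relative entropies, and the one of \<open>m\<close> with respect to \<open>m*\<close>
is nonnegative.\<close>

lemma entropy_le_symmetrised:
  assumes t: "t \<ge> 0"
  shows "tint (\<lambda>x. ms x * (ln (ms x) - ln (m t x))) \<le> tint (\<lambda>x. (m t x - ms x) * (ln (m t x) - ln (ms x)))"
proof -
  note [continuous_intros] = continuous_entropy[OF t] continuous_flow[OF t] continuous_stationary
  have "tint (\<lambda>x. ms x * (ln (ms x) - ln (m t x)) + m t x - ms x)
      \<le> tint (\<lambda>x. (m t x - ms x) * (ln (m t x) - ln (ms x)))"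
  proof (intro tint_mono continuous_entropy[OF t])
    fix x
    have "0 \<le> (sqrt (ms x) - sqrt (m t x))\<^sup>2" by simp
    also have "\<dots> \<le> m t x * (ln (m t x) - ln (ms x)) - m t x + ms x"
      by (rule entropy_ge_hellinger[OF m_pos[OF t] ms_pos])
    finally show "ms x * (ln (ms x) - ln (m t x)) + m t x - ms x \<le> (m t x - ms x) * (ln (m t x) - ln (ms x))"
      by (simp add: algebra_simps)
  qed (intro continuous_intros)
  moreover have "tint (\<lambda>x. ms x * (ln (ms x) - ln (m t x)) + m t x - ms x)
      = tint (\<lambda>x. ms x * (ln (ms x) - ln (m t x))) + tint (m t) - tint ms"
    by (simp add: tint_add tint_diff continuous_intros)
  ultimately show ?thesis by (simp add: mass[OF t] mass_stationary)
qed

lemma lyapunov_bounds: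
  assumes t: "t \<ge> 0"
  shows "lyapunov t \<ge> 0" "tint (\<lambda>x. (u t x - us x)\<^sup>2) \<le> 2 * lyapunov t"
    "tint (\<lambda>x. (sqrt (m t x) - sqrt (ms x))\<^sup>2) \<le> lyapunov t"
proof -
  have sq: "tint (\<lambda>x. (u t x - us x)\<^sup>2) \<ge> 0" "tint (\<lambda>x. (sqrt (m t x) - sqrt (ms x))\<^sup>2) \<ge> 0"
    by (auto intro!: tint_nonneg continuous_entropy[OF t])
  note facts = sq hellinger_le_entropy[OF t] lyapunov_split[OF t]
  show "lyapunov t \<ge> 0" using facts by linarith
  show "tint (\<lambda>x. (u t x - us x)\<^sup>2) \<le> 2 * lyapunov t" using facts by linarith
  show "tint (\<lambda>x. (sqrt (m t x) - sqrt (ms x))\<^sup>2) \<le> lyapunov t" using facts by linarith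
qed

lemma L1_le_lyapunov:
  assumes t: "t \<ge> 0" and \<epsilon>: "\<epsilon> > 0"
  shows "tint (\<lambda>x. \<bar>m t x - ms x\<bar>) \<le> lyapunov t / (2 * \<epsilon>) + 2 * \<epsilon>"
proof -
  note [continuous_intros] = continuous_entropy[OF t] continuous_flow[OF t] continuous_stationary
  have "tint (\<lambda>x. \<bar>m t x - ms x\<bar>)
      \<le> tint (\<lambda>x. (sqrt (m t x) - sqrt (ms x))\<^sup>2 / (2 * \<epsilon>) + \<epsilon> * (ms x + m t x))"
    using \<epsilon> by (intro tint_mono abs_diff_le_hellinger m_pos[OF t] ms_pos) (auto intro!: continuous_intros)
  also have "\<dots> = tint (\<lambda>x. (sqrt (m t x) - sqrt (ms x))\<^sup>2) / (2 * \<epsilon>) + \<epsilon> * (tint ms + tint (m t))"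
    using \<epsilon> by (simp add: tint_add continuous_intros)
  also have "\<dots> \<le> lyapunov t / (2 * \<epsilon>) + 2 * \<epsilon>"
    using \<epsilon> lyapunov_bounds(3)[OF t] by (simp add: mass[OF t] mass_stationary divide_right_mono)
  finally show ?thesis .
qed

lemma dissipation_ge:
  assumes t: "t \<ge> 0"
  shows "dissipation_density t x \<ge> \<rho> / 2 * ms x * (norm (grad (u t) x - grad us x))\<^sup>2"
    "dissipation_density t x \<ge> 1 / real k * ((m t x - ms x) * (ln (m t x) - ln (ms x)))"
proof -
  have "\<rho> / 2 * (norm (P + grad us x - (P + grad (u t) x)))\<^sup>2 \<ge> 0" using \<rho> by simp
  then have "bregman x (P + grad us x) (P + grad (u t) x) \<ge> 0"
    using bregman_ge order_trans by blast
  then have 1: "m t x * bregman x (P + grad us x) (P + grad (u t) x) \<ge> 0"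
    using m_pos[OF t, of x] by simp
  have "ms x * bregman x (P + grad (u t) x) (P + grad us x) \<ge> ms x * (\<rho> / 2 * (norm (grad (u t) x - grad us x))\<^sup>2)"
    using bregman_ge[of "P + grad (u t) x" "P + grad us x" x] ms_pos[of x] by (intro mult_left_mono) auto
  then have 2: "ms x * bregman x (P + grad (u t) x) (P + grad us x) \<ge> \<rho> / 2 * ms x * (norm (grad (u t) x - grad us x))\<^sup>2"
    by (simp add: mult_ac)
  have 4: "\<rho> / 2 * ms x * (norm (grad (u t) x - grad us x))\<^sup>2 \<ge> 0" using \<rho> ms_pos[of x] by simp
  have 3: "1 / real k * ((m t x - ms x) * (ln (m t x) - ln (ms x))) \<ge> 0"
    using ln_product_nonneg[OF m_pos[OF t] ms_pos] by simp
  show "dissipation_density t x \<ge> \<rho> / 2 * ms x * (norm (grad (u t) x - grad us x))\<^sup>2"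
    "dissipation_density t x \<ge> 1 / real k * ((m t x - ms x) * (ln (m t x) - ln (ms x)))"
    unfolding dissipation_density_def using 1 2 3 4 by linarith+
qed

text \<open>The constant depends on the positive minimum of \<open>m*\<close>, on \<open>\<rho>\<close> and \<open>k\<close>, and on the dimension through the
Poincare inequality. The first Bregman term carries the weight \<open>m\<close>, for which no lower bound
uniform in time is known; only the second one, weighted by \<open>m*\<close>, yields the gradient estimate.\<close>

lemma dissipation_controls:
  obtains c where
    "\<And>t. t \<ge> 0 \<Longrightarrow> tint (\<lambda>x. (norm (grad (u t) x - grad us x))\<^sup>2) \<le> c * tint (dissipation_density t)"
    "\<And>t. t \<ge> 0 \<Longrightarrow> lyapunov t \<le> c * tint (dissipation_density t)"
    "\<And>t. t \<ge> 0 \<Longrightarrow> tint (dissipation_density t) \<ge> 0"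
proof -
  obtain a where a: "a > 0" "\<And>x. x \<in> cbox 0 1 \<Longrightarrow> a \<le> ms x"
    using positive_bound_on_cube[OF continuous_stationary(1) ms_pos] by blast
  define b where "b = 2 / (\<rho> * a)"
  define n where "n = real CARD('n)"
  have b: "b > 0" using a \<rho> by (simp add: b_def)
  let ?D = "\<lambda>t. tint (dissipation_density t)"
  let ?G = "\<lambda>t. tint (\<lambda>x. (norm (grad (u t) x - grad us x))\<^sup>2)"
  have G: "?G t \<le> b * ?D t" and L: "lyapunov t \<le> real k * ?D t + n / 4 * ?G t" and D: "?D t \<ge> 0"
    if t: "t \<ge> 0" for t
  proof -
    note [continuous_intros] = continuous_entropy[OF t] continuous_dissipation_density[OF t]
    have "?G t = b * tint (\<lambda>x. \<rho> / 2 * a * (norm (grad (u t) x - grad us x))\<^sup>2)"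
      using a \<rho> by (simp add: b_def)
    also have "tint (\<lambda>x. \<rho> / 2 * a * (norm (grad (u t) x - grad us x))\<^sup>2) \<le> ?D t"
    proof (intro tint_mono)
      fix x :: "real^'n" assume "x \<in> cbox 0 1"
      then have "\<rho> / 2 * a * (norm (grad (u t) x - grad us x))\<^sup>2 \<le> \<rho> / 2 * ms x * (norm (grad (u t) x - grad us x))\<^sup>2"
        using a \<rho> by (intro mult_right_mono mult_left_mono) auto
      also have "\<dots> \<le> dissipation_density t x" by (rule dissipation_ge(1)[OF t])
      finally show "\<rho> / 2 * a * (norm (grad (u t) x - grad us x))\<^sup>2 \<le> dissipation_density t x" .
    qed (intro continuous_intros)+
    finally show "?G t \<le> b * ?D t" using b by simp
    have "?G t \<ge> 0" by (auto intro!: tint_nonneg continuous_entropy[OF t])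
    then have "0 \<le> b * ?D t" using \<open>?G t \<le> b * ?D t\<close> by linarith
    then show "?D t \<ge> 0" using b by (simp add: zero_le_mult_iff)
    have "tint (\<lambda>x. 1 / real k * ((m t x - ms x) * (ln (m t x) - ln (ms x)))) \<le> ?D t"
      by (intro tint_mono dissipation_ge(2)[OF t]) (intro continuous_intros)+
    then have "tint (\<lambda>x. (m t x - ms x) * (ln (m t x) - ln (ms x))) \<le> real k * ?D t"
      using k by (simp add: pos_divide_le_eq mult.commute)
    with entropy_le_symmetrised[OF t]
    have entropy: "tint (\<lambda>x. ms x * (ln (ms x) - ln (m t x))) \<le> real k * ?D t" by linarith
    have "2 * tint (\<lambda>x. (u t x - us x)\<^sup>2) \<le> n * tint (\<lambda>x. (norm (grad (\<lambda>x. u t x - us x) x))\<^sup>2)"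
      unfolding n_def
    proof (rule poincare_torus)
      have "(\<lambda>x. u t x - us x) \<in> Ck_torus 2"
        by (intro Ck_torus_2_vector_space m_u_regular ms_us_regular t)
      then show "periodic (\<lambda>x. u t x - us x)" "cont_diff (\<lambda>x. u t x - us x)"
        by (auto simp: Ck_torus_2_iff)
      show "tint (\<lambda>x. u t x - us x) = 0"
        using mean[OF t] mean_us by (simp add: tint_diff continuous_flow[OF t] continuous_stationary)
    qed
    also have "(\<lambda>x. (norm (grad (\<lambda>x. u t x - us x) x))\<^sup>2) = (\<lambda>x. (norm (grad (u t) x - grad us x))\<^sup>2)"
      using m_u_regular(2)[OF t] ms_us_regular(2) by (simp add: grad_diff Ck_torus_2_iff)
    finally show "lyapunov t \<le> real k * ?D t + n / 4 * ?G t"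
      using entropy by (simp add: lyapunov_split[OF t])
  qed
  show ?thesis
  proof
    define c where "c = b + real k + n / 4 * b"
    fix t :: real assume t: "t \<ge> 0"
    have n: "n \<ge> 0" by (simp add: n_def)
    have "b * ?D t \<le> c * ?D t" using D[OF t] b n by (intro mult_right_mono) (auto simp: c_def)
    then show "?G t \<le> c * ?D t" using G[OF t] by linarith
    have "n / 4 * ?G t \<le> n / 4 * (b * ?D t)" using G[OF t] n by (intro mult_left_mono) auto
    then have "lyapunov t \<le> (real k + n / 4 * b) * ?D t" using L[OF t] by (simp add: algebra_simps)
    also have "\<dots> \<le> c * ?D t" using D[OF t] b by (intro mult_right_mono) (auto simp: c_def)
    finally show "lyapunov t \<le> c * ?D t" .
    show "?D t \<ge> 0" by (rule D[OF t])
  qed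
qed

text \<open>Along the times where the dissipation tends to zero everything converges. Beyond this sequence the
gradient is not controlled, but the monotone functional is, and it bounds \<open>L\<^sup>2\<close> and \<open>L\<^sup>1\<close> distances.\<close>

lemma flow_converges:
  "\<exists>\<tau> :: nat \<Rightarrow> real. (\<forall>i. \<tau> i \<ge> 0) \<and> filterlim \<tau> at_top sequentially \<and>
     converges_W12 (\<lambda>i. u (\<tau> i)) us sequentially"
  "converges_Lp 2 u us at_top"
  "converges_Lp 1 m ms at_top"
proof -
  obtain c where
    grad_le: "\<And>t. t \<ge> 0 \<Longrightarrow> tint (\<lambda>x. (norm (grad (u t) x - grad us x))\<^sup>2) \<le> c * tint (dissipation_density t)"
    and lyapunov_le: "\<And>t. t \<ge> 0 \<Longrightarrow> lyapunov t \<le> c * tint (dissipation_density t)"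
    and D: "\<And>t. t \<ge> 0 \<Longrightarrow> tint (dissipation_density t) \<ge> 0"
    using dissipation_controls by blast
  have lyapunov_mono: "lyapunov t \<le> lyapunov s" if "0 \<le> s" "s \<le> t" for s t
    by (rule dissipation(1)[OF lyapunov_derivative D lyapunov_bounds(1)]; (assumption | rule that))
  have "\<exists>\<tau> :: nat \<Rightarrow> real. (\<forall>i. \<tau> i \<ge> 0) \<and> filterlim \<tau> at_top sequentially \<and>
      (\<lambda>i. tint (dissipation_density (\<tau> i))) \<longlonglongrightarrow> 0"
    by (rule dissipation(2)[OF lyapunov_derivative D lyapunov_bounds(1)]; assumption)
  then obtain \<tau> :: "nat \<Rightarrow> real" where \<tau>: "\<And>i. \<tau> i \<ge> 0" "filterlim \<tau> at_top sequentially"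
    and lim: "(\<lambda>i. tint (dissipation_density (\<tau> i))) \<longlonglongrightarrow> 0"
    by blast
  have clim: "(\<lambda>i. c * tint (dissipation_density (\<tau> i))) \<longlonglongrightarrow> 0"
    using tendsto_mult_right_zero[OF lim] by simp
  have nonneg: "\<forall>\<^sub>F t::real in at_top. t \<ge> 0" by (rule eventually_ge_at_top)
  have "(\<lambda>i. lyapunov (\<tau> i)) \<longlonglongrightarrow> 0"
    by (rule tendsto_sandwich[OF _ _ tendsto_const clim])
      (auto intro!: always_eventually lyapunov_bounds(1) lyapunov_le \<tau>)
  have lyapunov_lim: "(lyapunov \<longlongrightarrow> 0) at_top"
  proof (rule order_tendstoI)
    fix e :: real assume "e < 0"
    show "\<forall>\<^sub>F t in at_top. e < lyapunov t"
      using nonneg by eventually_elim (use \<open>e < 0\<close> lyapunov_bounds(1) in fastforce)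
  next
    fix e :: real assume "0 < e"
    from order_tendstoD(2)[OF \<open>(\<lambda>i. lyapunov (\<tau> i)) \<longlonglongrightarrow> 0\<close> this]
    obtain i where i: "lyapunov (\<tau> i) < e" by (auto simp: eventually_sequentially)
    show "\<forall>\<^sub>F t in at_top. lyapunov t < e"
      using eventually_ge_at_top[of "\<tau> i"]
      by eventually_elim (use lyapunov_mono[OF \<tau>(1)] i le_less_trans in blast)
  qed
  have L2_lim: "((\<lambda>t. tint (\<lambda>x. (norm (u t x - us x))\<^sup>2)) \<longlongrightarrow> 0) at_top"
  proof (rule tendsto_sandwich[OF _ _ tendsto_const])
    show "((\<lambda>t. 2 * lyapunov t) \<longlongrightarrow> 0) at_top"
      using tendsto_mult_right_zero[OF lyapunov_lim] by simp
    show "\<forall>\<^sub>F t in at_top. 0 \<le> tint (\<lambda>x. (norm (u t x - us x))\<^sup>2)"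
      using nonneg by eventually_elim (auto intro!: tint_nonneg continuous_entropy)
    show "\<forall>\<^sub>F t in at_top. tint (\<lambda>x. (norm (u t x - us x))\<^sup>2) \<le> 2 * lyapunov t"
      using nonneg by eventually_elim (simp add: lyapunov_bounds(2))
  qed
  have u_cont: "\<forall>\<^sub>F t in at_top. continuous_on UNIV (u t)"
    and m_cont: "\<forall>\<^sub>F t in at_top. continuous_on UNIV (m t)"
    using nonneg by (eventually_elim, simp add: continuous_flow)+
  show "converges_Lp 2 u us at_top"
    by (rule converges_L2I[OF u_cont continuous_stationary(2) L2_lim])
  have L1_lim: "((\<lambda>t. tint (\<lambda>x. \<bar>m t x - ms x\<bar>)) \<longlongrightarrow> 0) at_top"
  proof (rule tendstoI)
    fix e :: real assume e: "0 < e"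
    \<comment> \<open>With \<open>\<epsilon> = e / 4\<close> the bound \<open>lyapunov t / (2 * \<epsilon>) + 2 * \<epsilon>\<close> is below \<open>e\<close> as soon as
      \<open>lyapunov t < e\<^sup>2 / 4\<close>.\<close>
    have "\<forall>\<^sub>F t in at_top. lyapunov t < e\<^sup>2 / 4"
      by (rule order_tendstoD(2)[OF lyapunov_lim]) (use e in simp)
    with nonneg show "\<forall>\<^sub>F t in at_top. dist (tint (\<lambda>x. \<bar>m t x - ms x\<bar>)) 0 < e"
    proof eventually_elim
      case (elim t)
      have "tint (\<lambda>x. \<bar>m t x - ms x\<bar>) \<le> lyapunov t / (2 * (e / 4)) + 2 * (e / 4)"
        using e by (intro L1_le_lyapunov elim) simp
      also have "lyapunov t / (2 * (e / 4)) < (e\<^sup>2 / 4) / (2 * (e / 4))"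
        using elim e by (intro divide_strict_right_mono) auto
      also have "(e\<^sup>2 / 4) / (2 * (e / 4)) + 2 * (e / 4) = e"
        using e by (simp add: power2_eq_square)
      finally have "tint (\<lambda>x. \<bar>m t x - ms x\<bar>) < e" by simp
      moreover have "tint (\<lambda>x. \<bar>m t x - ms x\<bar>) \<ge> 0"
        by (intro tint_nonneg continuous_intros continuous_flow continuous_stationary elim) simp
      ultimately show ?case by simp
    qed
  qed
  show "converges_Lp 1 m ms at_top"
    by (rule converges_L1I[OF m_cont continuous_stationary(1) L1_lim])
  have "converges_W12 (\<lambda>i. u (\<tau> i)) us sequentially"
    unfolding converges_W12_def
  proof (intro exI conjI)
    have wg: "v \<in> Ck_torus 2 \<Longrightarrow> has_weak_grad v (grad v)" for v :: "real^'n \<Rightarrow> real"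
      by (auto simp: Ck_torus_2_iff intro: has_weak_grad_classical)
    show "\<forall>\<^sub>F i in sequentially. has_weak_grad (u (\<tau> i)) (grad (u (\<tau> i)))"
      by (intro always_eventually allI wg m_u_regular \<tau>)
    show "has_weak_grad us (grad us)" by (intro wg ms_us_regular)
    show "converges_Lp 2 (\<lambda>i. u (\<tau> i)) us sequentially"
      by (rule converges_L2I[OF _ continuous_stationary(2) filterlim_compose[OF L2_lim \<tau>(2)]])
        (intro always_eventually allI continuous_flow \<tau>)
    show "converges_Lp 2 (\<lambda>i. grad (u (\<tau> i))) (grad us) sequentially"
    proof (rule converges_L2I[OF _ continuous_stationary(3)])
      show "(\<lambda>i. tint (\<lambda>x. (norm (grad (u (\<tau> i)) x - grad us x))\<^sup>2)) \<longlonglongrightarrow> 0"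
        by (rule tendsto_sandwich[OF _ _ tendsto_const clim])
          (auto intro!: always_eventually grad_le \<tau> tint_nonneg continuous_entropy)
    qed (intro always_eventually allI continuous_flow \<tau>)
  qed
  then show "\<exists>\<tau> :: nat \<Rightarrow> real. (\<forall>i. \<tau> i \<ge> 0) \<and> filterlim \<tau> at_top sequentially \<and>
     converges_W12 (\<lambda>i. u (\<tau> i)) us sequentially"
    using \<tau> by blast
qed

end

theorem theorem1p1:
  fixes k :: nat
    and P :: "real^'n"
    and H :: "real^'n \<Rightarrow> real^'n \<Rightarrow> real"
    and m u :: "real \<Rightarrow> real^'n \<Rightarrow> real"
    and ms us :: "real^'n \<Rightarrow> real"
  assumes "k > 0"
    and "smooth_hamiltonian H"
    and "strictly_convex_in_p H"
    and "growth_bounds H"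
    and "hessian_riemannian_flow k H P m u"
    and "(LINT x|torus. m 0 x) = 1"
    and "(LINT x|torus. u 0 x) = 0"
    and "stationary_solution k H P ms us"
    and "(LINT x|torus. us x) = 0"
  shows "(\<exists>\<tau> :: nat \<Rightarrow> real. (\<forall>i. \<tau> i \<ge> 0) \<and> filterlim \<tau> at_top sequentially \<and>
            converges_W12 (\<lambda>i. u (\<tau> i)) us sequentially) \<and>
         converges_Lp 2 u us at_top \<and>
         converges_Lp 1 m ms at_top"
proof -
  obtain \<rho> where \<rho>: "\<rho> > 0"
    "\<And>x p \<xi>. (\<Sum>i\<in>UNIV. \<Sum>j\<in>UNIV. D2ppH H x p $ i $ j * \<xi> $ i * \<xi> $ j) \<ge> \<rho> * (norm \<xi>)\<^sup>2"
    using \<open>strictly_convex_in_p H\<close> unfolding strictly_convex_in_p_def by blast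
  obtain m' u' where flow: "C1_curve (Ck_torus 1) C1_norm m m'" "C1_curve (Ck_torus 2) C2_norm u u'"
    and eqs: "\<And>t x. t \<ge> 0 \<Longrightarrow> m' t x = - (m t x * (- H x (P + grad (u t) x)
        + Hbar_flow k H P (m t) (u t) + 1 / real k * ln (m t x)))"
      "\<And>t x. t \<ge> 0 \<Longrightarrow> u' t x = - (- divergence (\<lambda>y. m t y *\<^sub>R DpH H y (P + grad (u t) y)) x)"
    and pos: "\<And>t x. t \<ge> 0 \<Longrightarrow> m t x > 0"
    using \<open>hessian_riemannian_flow k H P m u\<close>
    unfolding hessian_riemannian_flow_def C1_pos_torus_def by blast
  have cont: "f \<in> Ck_torus 2 \<Longrightarrow> continuous_on UNIV f" "f \<in> Ck_torus 1 \<Longrightarrow> continuous_on UNIV f"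
    for f :: "real^'n \<Rightarrow> real"
    unfolding Ck_torus_1_iff Ck_torus_2_iff by (simp_all add: cont_diff_continuous)
  have "m 0 \<in> Ck_torus 1" "u 0 \<in> Ck_torus 2"
    using flow by (auto simp: C1_curve_def)
  moreover have "us \<in> Ck_torus 2"
    using \<open>stationary_solution k H P ms us\<close>
    by (simp add: stationary_solution_def smooth_torus_def smooth_def Ck_torus_def)
  ultimately have "tint (m 0) = 1" "tint (u 0) = 0" "tint us = 0"
    using assms(6,7,9) by (auto simp: torus_LINT_eq_tint(2) cont)
  then interpret mean_field_flow k P H \<rho> m u m' u' ms us
    using assms(1,2,8) \<rho> flow eqs pos by unfold_locales (auto simp: flux_def[abs_def])
  show ?thesis using flow_converges by blast
qed

end
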